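(* Let $m,n\ge1$ be integers and let $\mathcal{A}$ be a configuration of type $(m,1^n)$ in $\mathbb{C}^2$. If $\mathcal{A}$ is Gorenstein, then $\mathcal{A}$ is equivalent to the configuration $\mathcal{A}_{(m,1^n)}$.
   Context: A configuration of type $(m,1^n)$ consists of $n+1$ pairwise non-collinear vectors $\beta_0,\dots,\beta_n\in\mathbb{C}^2$ with multiplicities $m_0=m$, $m_i=1$ for $1\le i\le n$. All vectors are assumed non-isotropic: $(\beta_i,\beta_i)\ne0$ for $(u,v)=u_1v_1+u_2v_2$. The graded algebra $Q_{\mathcal{A}}\subset\mathbb{C}[x_1,x_2]$ of quasi-invariants consists of the polynomials $p$ such that $\partial_{\beta_i}^{2s-1}p|_{\Pi_i}=0$ for all $i$ and all $1\le s\le m_i$, where $\partial_{\beta_i}=(\beta_i,\frac{\partial}{\partial x})$ and $\Pi_i=\{x:(\beta_i,x)=0\}$. Its Hilbert series is $P_{\mathcal{A}}(t)=\sum_{k\ge0}\dim Q_{\mathcal{A}}^{(k)}t^k$, where $Q_{\mathcal{A}}^{(k)}$ is the space of homogeneous elements of degree $k$; it is a rational function of $t$. The configuration $\mathcal{A}$ is called Gorenstein if $P_{\mathcal{A}}(t^{-1})=t^MP_{\mathcal{A}}(t)$ for some $M\in\mathbb{Z}$ (as rational functions). Two configurations are equivalent if one is obtained from the other by an orthogonal transformation of $\mathbb{C}^2$ (preserving $(\cdot,\cdot)$) and multiplication of vectors by non-zero scalars, keeping multiplicities. The configuration $\mathcal{A}_{(m,1^n)}$: vectors $(\cos\varphi_s,\sin\varphi_s)$,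 $0\le s\le n$, the zeroth being $(1,0)$ with multiplicity $m$ and the others having multiplicity $1$, such that, with $z_s=e^{2i\varphi_s}$, the elementary symmetric polynomials $e_k=e_k(z_1,\dots,z_n)$ have the values $e_k=(-1)^k\binom{n}{k}\binom{m+k-1}{k}\binom{m+n-1}{k}^{-1}$ for $1\le k\le n$. *)

theory Defs
  imports "HOL-Analysis.Analysis" "HOL-Computational_Algebra.Computational_Algebra"
begin

section \<open>Configurations in the complex plane\<close>

text \<open>The form is bilinear, not Hermitian; a non-zero vector may be isotropic.\<close>

definition bil :: "complex^2 \<Rightarrow> complex^2 \<Rightarrow> complex" where
  "bil u v = u $ 1 * v $ 1 + u $ 2 * v $ 2"

text \<open>A configuration is a set of pairs (vector, multiplicity).\<close>

type_synonym configuration = "((complex^2) \<times> nat) set"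

definition admissible_vectors :: "nat \<Rightarrow> (nat \<Rightarrow> complex^2) \<Rightarrow> bool" where
  "admissible_vectors n \<beta> \<longleftrightarrow>
     (\<forall>i\<le>n. bil (\<beta> i) (\<beta> i) \<noteq> 0) \<and>
     (\<forall>i\<le>n. \<forall>j\<le>n. i \<noteq> j \<longrightarrow> (\<forall>c. \<beta> i \<noteq> c *s \<beta> j))"

definition config :: "nat \<Rightarrow> nat \<Rightarrow> (nat \<Rightarrow> complex^2) \<Rightarrow> configuration" where
  "config m n \<beta> = insert (\<beta> 0, m) ((\<lambda>i. (\<beta> i, 1)) ` {1..n})"

definition config_of_type :: "nat \<Rightarrow> nat \<Rightarrow> configuration \<Rightarrow> bool" where
  "config_of_type m n A \<longleftrightarrow> (\<exists>\<beta>. admissible_vectors n \<beta> \<and> A = config m n \<beta>)"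

text \<open>
  Complex orthogonal matrices (inverse equal to the transpose) are those preserving the form.
  The order in which the vectors are listed plays no role.
\<close>

definition config_equiv :: "configuration \<Rightarrow> configuration \<Rightarrow> bool" where
  "config_equiv A B \<longleftrightarrow>
     (\<exists>(T :: complex^2^2) f. orthogonal_matrix T \<and> bij_betw f A B \<and>
        (\<forall>(u, k)\<in>A. \<exists>c. c \<noteq> 0 \<and> f (u, k) = (c *s (T *v u), k)))"

section \<open>Quasi-invariants\<close>

text \<open>
  The polynomial ring in two variables is represented as univariate polynomials in the second
  variable whose coefficients are polynomials in the first one.
\<close>

type_synonym poly2 = "complex poly poly"

definition eval2 :: "poly2 \<Rightarrow> complex^2 \<Rightarrow> complex" where
  "eval2 p x = poly (poly p [:x $ 2:]) (x $ 1)"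

definition dir_deriv :: "complex^2 \<Rightarrow> poly2 \<Rightarrow> poly2" where
  "dir_deriv \<beta> p = smult [:\<beta> $ 1:] (map_poly pderiv p) + smult [:\<beta> $ 2:] (pderiv p)"

definition quasi_invariants :: "configuration \<Rightarrow> poly2 set" where
  "quasi_invariants A =
     {p. \<forall>(\<beta>, k)\<in>A. \<forall>s\<in>{1..k}. \<forall>x. bil \<beta> x = 0 \<longrightarrow>
           eval2 ((dir_deriv \<beta> ^^ (2 * s - 1)) p) x = 0}"

definition homogeneous :: "nat \<Rightarrow> poly2 set" where
  "homogeneous k = {p. \<forall>i j. coeff (coeff p j) i \<noteq> 0 \<longrightarrow> i + j = k}"

interpretation poly2: vector_space "\<lambda>(c :: complex) (p :: poly2). smult [:c:] p"
  by standard (simp_all add: smult_add_right smult_add_left [symmetric] one_pCons [symmetric] mult.commute)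

section \<open>Hilbert series and the Gorenstein property\<close>

definition hilbert_series :: "configuration \<Rightarrow> complex fps" where
  "hilbert_series A =
     Abs_fps (\<lambda>k. of_nat (poly2.dim (quasi_invariants A \<inter> homogeneous k)))"

text \<open>The variable of the field of rational functions, and substitution into a polynomial.\<close>

definition ratvar :: "complex poly fract" where
  "ratvar = to_fract [:0, 1:]"

definition subst_poly :: "complex poly \<Rightarrow> complex poly fract \<Rightarrow> complex poly fract" where
  "subst_poly p r = poly (map_poly (\<lambda>c. to_fract [:c:]) p) r"

text \<open>
  The Hilbert series is the expansion at 0 of the rational function \<open>N / D\<close>, which is unique;
  the symmetry is an identity in the field of rational functions.
\<close>

definition gorenstein :: "configuration \<Rightarrow> bool" where
  "gorenstein A \<longleftrightarrow>
     (\<exists>N D. D \<noteq> 0 \<and> hilbert_series A * fps_of_poly D = fps_of_poly N \<and>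
        (\<exists>M::int. subst_poly N (inverse ratvar) / subst_poly D (inverse ratvar) =
           ratvar powi M * (subst_poly N ratvar / subst_poly D ratvar)))"

section \<open>The special configuration\<close>

definition elem_sym :: "nat \<Rightarrow> nat \<Rightarrow> (nat \<Rightarrow> complex) \<Rightarrow> complex" where
  "elem_sym n k z = (\<Sum>S | S \<subseteq> {1..n} \<and> card S = k. \<Prod>s\<in>S. z s)"

definition angle_vec :: "complex \<Rightarrow> complex^2" where
  "angle_vec \<phi> = vector [cos \<phi>, sin \<phi>]"

text \<open>
  The elementary symmetric values determine the \<open>z s\<close> up to order, hence the angles up to order
  and multiples of \<open>pi\<close>, that is, the configuration up to signs of its vectors. The predicate
  holds for each of these representatives.
\<close>

definition special_config :: "nat \<Rightarrow> nat \<Rightarrow> configuration \<Rightarrow> bool" where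
  "special_config m n B \<longleftrightarrow>
     (\<exists>\<phi> :: nat \<Rightarrow> complex.
        \<phi> 0 = 0 \<and>
        admissible_vectors n (\<lambda>s. angle_vec (\<phi> s)) \<and>
        B = config m n (\<lambda>s. angle_vec (\<phi> s)) \<and>
        (\<forall>k\<in>{1..n}. elem_sym n k (\<lambda>s. exp (2 * \<i> * \<phi> s)) =
           (-1) ^ k * of_nat (n choose k) * of_nat ((m + k - 1) choose k)
             / of_nat ((m + n - 1) choose k)))"

end

theory Submission
  imports Defs
begin

text \<open>
  Let \<open>N = m + n\<close>. A homogeneous polynomial of degree \<open>k\<close> is quasi-invariant iff \<open>N\<close> linear functionals
  vanish on it, and for large \<open>k\<close> these are independent, so \<open>dim Q\<^sup>k = k + 1 - N\<close>. Hence the numerator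
  \<open>(1 - t)\<^sup>2 P(t)\<close> is a polynomial with value 1 and derivative \<open>N\<close> at 1; if \<open>P\<close> is symmetric, it is
  palindromic, so its degree is \<open>2 N\<close>, and this forces \<open>dim Q\<^sup>k \<noteq> k + 1 - N\<close> for \<open>k = 2 N - 2\<close>.

  In the isotropic coordinates \<open>x\<^sub>1 \<plusminus> \<i> x\<^sub>2\<close> the angular derivative of a binary form of even degree \<open>k\<close> is an
  arbitrary univariate polynomial \<open>h\<close> of degree at most \<open>k\<close> without the middle monomial, and the
  conditions say that \<open>h\<close> has prescribed zeros at points \<open>\<zeta>\<^sub>i\<close> attached to the lines. Let \<open>A\<close> be the
  polynomial with a root of order \<open>2 m - 1\<close> at \<open>\<zeta>\<^sub>0\<close> and simple roots at the other \<open>\<zeta>\<^sub>i\<close>. If one of the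
  coefficients of \<open>A\<close> at \<open>m, ..., m + n - 1\<close> were non-zero, a multiple of \<open>A\<close> by a monomial could be used to
  cancel middle coefficients, and the conditions would be independent in degree \<open>2 N - 2\<close>. So these
  \<open>n\<close> coefficients vanish. After scaling \<open>\<zeta>\<^sub>0\<close> to 1, a hypergeometric operator maps \<open>A\<close> to a
  polynomial with at most \<open>2 m - 2\<close> monomials and a zero of order at least \<open>2 m - 1\<close> at 1, that is, to 0;
  Euler's transformation then gives a two-term recursion for the elementary symmetric
  polynomials of the \<open>\<zeta>\<^sub>i / \<zeta>\<^sub>0\<close>.
\<close>

section \<open>Dimensions of spaces of homogeneous polynomials\<close>

text \<open>A basis of the kernel together with \<open>p\<close> is a basis of \<open>S\<close>,
  since subtracting \<open>f x / f p\<close> times \<open>p\<close> moves any \<open>x\<close> into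
  the kernel. The finite set \<open>B\<close> keeps these bases finite, so that \<open>dim\<close>
  counts them properly.\<close>

lemma (in vector_space) dim_kernel_functional:
  assumes S: "subspace S" and fin: "S \<subseteq> span B" "finite B"
    and f: "Vector_Spaces.linear scale (*) f" and p: "p \<in> S" "f p \<noteq> 0"
  shows "dim S = Suc (dim {x \<in> S. f x = 0})"
proof -
  interpret f: Vector_Spaces.linear scale "(*)" f by (fact f)
  let ?K = "{x \<in> S. f x = 0}"
  have K: "subspace ?K"
    using S by (auto simp: subspace_def f.add f.scale f.zero)
  obtain C where C: "C \<subseteq> ?K" "independent C" "?K \<subseteq> span C" "card C = dim ?K"
    using basis_exists by blast
  have finC: "finite C"
    using independent_span_bound[OF fin(2) C(2)] C(1) fin(1) by auto
  have spanC: "span C \<subseteq> ?K"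
    using span_minimal[OF C(1) K] .
  have pn: "p \<notin> span C"
    using spanC p by auto
  have "S \<subseteq> span (insert p C)"
  proof
    fix x assume x: "x \<in> S"
    define y where "y = x - scale (f x / f p) p"
    have "y \<in> S"
      using S x p(1) unfolding y_def by (intro subspace_diff subspace_scale)
    moreover have "f y = 0"
      using p(2) by (simp add: y_def f.diff f.scale)
    ultimately have "y \<in> span C" using C(3) by auto
    then have "y \<in> span (insert p C)"
      using span_mono[of C "insert p C"] by auto
    then have "y + scale (f x / f p) p \<in> span (insert p C)"
      by (rule span_add[OF _ span_scale[OF span_base]]) simp
    then show "x \<in> span (insert p C)" by (simp only: y_def diff_add_cancel)
  qed
  moreover have "independent (insert p C)"
    using pn C(2) by (rule independent_insertI)
  moreover have "insert p C \<subseteq> S" using C(1) p(1) by auto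
  ultimately have "dim S = card (insert p C)"
    by (metis basis_card_eq_dim)
  also have "\<dots> = Suc (card C)"
    using finC pn span_base by (subst card_insert_disjoint) auto
  finally show ?thesis using C(4) by simp
qed

text \<open>The matrix \<open>f s (w t)\<close> is triangular with non-zero diagonal: each witness
  lies in the common kernel of the earlier functionals but not in that of its own, so each
  functional lowers the dimension by one.\<close>

lemma (in vector_space) dim_kernel_triangular:
  assumes S: "subspace S" and fin: "S \<subseteq> span B" "finite B"
    and f: "\<And>t. t < N \<Longrightarrow> Vector_Spaces.linear scale (*) (f t)"
    and w: "\<And>t. t < N \<Longrightarrow> w t \<in> S" "\<And>t. t < N \<Longrightarrow> f t (w t) \<noteq> 0"
      "\<And>s t. s < t \<Longrightarrow> t < N \<Longrightarrow> f s (w t) = 0"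
  shows "dim S = dim {x \<in> S. \<forall>t<N. f t x = 0} + N"
  using f w
proof (induction N)
  case 0
  then show ?case by simp
next
  case (Suc N)
  let ?K = "{x \<in> S. \<forall>t<N. f t x = 0}"
  have hom: "module_hom scale (*) (f t)" if "t < N" for t
    using Suc.prems(1)[of t] that by (simp add: linear_iff_module_hom)
  have K: "subspace ?K"
    using S by (auto simp: subspace_def module_hom.add[OF hom] module_hom.scale[OF hom]
        module_hom.zero[OF hom])
  have "dim S = dim ?K + N"
    by (rule Suc.IH) (use Suc.prems in auto)
  moreover have "dim ?K = Suc (dim {x \<in> ?K. f N x = 0})"
    by (rule dim_kernel_functional[OF K _ fin(2) Suc.prems(1), of _ "w N"])
      (use fin(1) Suc.prems in auto)
  moreover have "{x \<in> ?K. f N x = 0} = {x \<in> S. \<forall>t<Suc N. f t x = 0}"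
    by (auto simp: less_Suc_eq)
  ultimately show ?case by simp
qed

lemma subspace_homogeneous: "poly2.subspace (homogeneous k)"
  unfolding poly2.subspace_def homogeneous_def
  by (auto simp: coeff_smult) (metis add.right_neutral add.commute)

lemma homogeneous_span:
  "homogeneous k \<subseteq> poly2.span ((\<lambda>i. monom (monom 1 i) (k - i)) ` {..k})"
proof
  fix p assume p: "p \<in> homogeneous k"
  have "p = (\<Sum>i\<le>k. smult [:coeff (coeff p (k - i)) i:] (monom (monom 1 i) (k - i)))"
  proof (rule poly_eqI, rule poly_eqI)
    fix j i
    have "coeff (coeff (\<Sum>i\<le>k. smult [:coeff (coeff p (k - i)) i:] (monom (monom 1 i) (k - i))) j) i
        = (\<Sum>i'\<le>k. if i' = i \<and> k - i = j then coeff (coeff p (k - i)) i else 0)"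
      by (auto simp: coeff_sum intro!: sum.cong)
    also have "\<dots> = (if i \<le> k \<and> k - i = j then coeff (coeff p (k - i)) i else 0)"
      by (auto simp: if_if_eq_conj[symmetric] sum.delta)
    also have "\<dots> = coeff (coeff p j) i"
      using p unfolding homogeneous_def by fastforce
    finally show "coeff (coeff p j) i = coeff (coeff (\<Sum>i\<le>k. smult [:coeff (coeff p (k - i)) i:]
      (monom (monom 1 i) (k - i))) j) i" ..
  qed
  also have "\<dots> \<in> poly2.span ((\<lambda>i. monom (monom 1 i) (k - i)) ` {..k})"
    by (intro poly2.span_sum poly2.span_scale poly2.span_base) auto
  finally show "p \<in> poly2.span ((\<lambda>i. monom (monom 1 i) (k - i)) ` {..k})" .
qed

lemma linear_poly2I:
  assumes "\<And>p q. f (p + q) = f p + f q" "\<And>c p. f (smult [:c:] p) = c * f p"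
  shows "Vector_Spaces.linear (\<lambda>c (p::poly2). smult [:c:] p) (*) f"
proof -
  interpret v: vector_space "(*) :: complex \<Rightarrow> complex \<Rightarrow> complex"
    by standard (auto simp: algebra_simps)
  show ?thesis by standard (use assms in auto)
qed

text \<open>The coefficient functionals with the monomials as witnesses meet the triangular
  criterion, and their common kernel is 0.\<close>

lemma dim_homogeneous: "poly2.dim (homogeneous k) = k + 1"
proof -
  have "poly2.dim (homogeneous k) =
      poly2.dim {p \<in> homogeneous k. \<forall>i<k + 1. coeff (coeff p (k - i)) i = 0} + (k + 1)"
    by (rule poly2.dim_kernel_triangular[OF subspace_homogeneous homogeneous_span,
          where w = "\<lambda>i. monom (monom 1 i) (k - i)"])
      (auto intro!: linear_poly2I simp: homogeneous_def)
  moreover have "{p \<in> homogeneous k. \<forall>i<k + 1. coeff (coeff p (k - i)) i = 0} = {0}"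
  proof (intro equalityI subsetI)
    fix p assume p: "p \<in> {p \<in> homogeneous k. \<forall>i<k + 1. coeff (coeff p (k - i)) i = 0}"
    have "coeff (coeff p j) i = 0" for i j
    proof (cases "i + j = k")
      case True
      then have "i < k + 1" "j = k - i" by auto
      then show ?thesis using p by auto
    qed (use p in \<open>auto simp: homogeneous_def\<close>)
    then show "p \<in> {0}" by (auto intro!: poly_eqI)
  qed (auto simp: homogeneous_def)
  moreover have "poly2.dim {0} = 0"
    by (metis poly2.dim_span_eq_card_independent poly2.independent_empty poly2.span_empty card.empty)
  ultimately show ?thesis by simp
qed

section \<open>Directional derivatives on a line\<close>

definition perp :: "complex^2 \<Rightarrow> complex^2" where
  "perp \<beta> = vector [- \<beta> $ 2, \<beta> $ 1]"

text \<open>\<open>bplus\<close> and \<open>bminus\<close> are the isotropic coordinates of a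
  vector, in which the quadratic form is a product.\<close>

definition bplus :: "complex^2 \<Rightarrow> complex" where
  "bplus \<beta> = \<beta> $ 1 + \<i> * \<beta> $ 2"

definition bminus :: "complex^2 \<Rightarrow> complex" where
  "bminus \<beta> = \<beta> $ 1 - \<i> * \<beta> $ 2"

lemma bplus_bminus: "bplus \<beta> * bminus \<beta> = bil \<beta> \<beta>"
proof -
  have "\<i> * \<i> = -1" by simp
  then show ?thesis unfolding bplus_def bminus_def bil_def by algebra
qed

lemma orthogonal_iff_perp:
  assumes "bil \<beta> \<beta> \<noteq> 0"
  shows "bil \<beta> x = 0 \<longleftrightarrow> (\<exists>c. x = c *s perp \<beta>)"
proof
  assume x: "bil \<beta> x = 0"
  \<comment> \<open>The numerator is \<open>bil (perp \<beta>) x\<close>, and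
    \<open>perp \<beta>\<close> has the same square as \<open>\<beta>\<close>.\<close>
  define c where "c = (\<beta> $ 1 * x $ 2 - \<beta> $ 2 * x $ 1) / bil \<beta> \<beta>"
  have "bil \<beta> \<beta> * x $ 1 = (\<beta> $ 1 * x $ 2 - \<beta> $ 2 * x $ 1) * - \<beta> $ 2"
    "bil \<beta> \<beta> * x $ 2 = (\<beta> $ 1 * x $ 2 - \<beta> $ 2 * x $ 1) * \<beta> $ 1"
    using x unfolding bil_def by algebra+
  then have "x = c *s perp \<beta>"
    using assms by (simp add: vec_eq_iff forall_2 perp_def c_def field_simps)
  then show "\<exists>c. x = c *s perp \<beta>" ..
qed (auto simp: bil_def perp_def)

section \<open>Evaluation and directional derivatives along a line\<close>

lemma eval2_0 [simp]: "eval2 0 x = 0"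
  and eval2_add: "eval2 (p + q) x = eval2 p x + eval2 q x"
  and eval2_mult: "eval2 (p * q) x = eval2 p x * eval2 q x"
  and eval2_smult: "eval2 (smult c p) x = poly c (x $ 1) * eval2 p x"
  and eval2_pCons: "eval2 (pCons c p) x = poly c (x $ 1) + x $ 2 * eval2 p x"
  by (simp_all add: eval2_def)

lemma eval2_scale: "eval2 (smult [:c:] p) x = c * eval2 p x"
  by (simp add: eval2_smult)

lemma eval2_power: "eval2 (p ^ r) x = eval2 p x ^ r"
  by (simp add: eval2_def)

lemma eval2_sum: "eval2 (sum f S) x = (\<Sum>s\<in>S. eval2 (f s) x)"
  by (simp add: eval2_def poly_sum)

lemma dir_deriv_0 [simp]: "dir_deriv \<beta> 0 = 0"
  by (simp add: dir_deriv_def)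

lemma coeff_dir_deriv:
  "coeff (coeff (dir_deriv \<beta> p) j) i =
    \<beta> $ 1 * (of_nat (Suc i) * coeff (coeff p j) (Suc i)) + \<beta> $ 2 * (of_nat (Suc j) * coeff (coeff p (Suc j)) i)"
  by (simp add: dir_deriv_def coeff_map_poly coeff_pderiv of_nat_mult_conv_smult del: of_nat_Suc)

lemma dir_deriv_add: "dir_deriv \<beta> (p + q) = dir_deriv \<beta> p + dir_deriv \<beta> q"
  by (intro poly_eqI) (simp add: coeff_dir_deriv algebra_simps)

lemma dir_deriv_smult: "dir_deriv \<beta> (smult [:c:] p) = smult [:c:] (dir_deriv \<beta> p)"
  by (intro poly_eqI) (simp add: coeff_dir_deriv algebra_simps)

lemma dir_deriv_iter_add: "(dir_deriv \<beta> ^^ r) (p + q) = (dir_deriv \<beta> ^^ r) p + (dir_deriv \<beta> ^^ r) q"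
  by (induction r) (simp_all add: dir_deriv_add)

lemma dir_deriv_iter_smult: "(dir_deriv \<beta> ^^ r) (smult [:c:] p) = smult [:c:] ((dir_deriv \<beta> ^^ r) p)"
  by (induction r) (simp_all add: dir_deriv_smult)

lemma DERIV_eval2_line:
  "((\<lambda>\<tau>. eval2 p (x + \<tau> *s \<beta>)) has_field_derivative eval2 (dir_deriv \<beta> p) (x + \<tau> *s \<beta>)) (at \<tau>)"
proof (induction p)
  case (pCons c p)
  have d: "dir_deriv \<beta> (pCons c p) =
      smult [:\<beta> $ 1:] (pCons (pderiv c) (map_poly pderiv p)) + smult [:\<beta> $ 2:] (p + pCons 0 (pderiv p))"
    using pCons.hyps by (simp add: dir_deriv_def pderiv_pCons map_poly_pCons)
  have 1: "((\<lambda>\<tau>. poly c ((x + \<tau> *s \<beta>) $ 1)) has_field_derivative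
      poly (pderiv c) ((x + \<tau> *s \<beta>) $ 1) * \<beta> $ 1) (at \<tau>)"
    by (rule DERIV_chain2[OF poly_DERIV]) (auto intro!: derivative_eq_intros)
  have 2: "((\<lambda>\<tau>. (x + \<tau> *s \<beta>) $ 2) has_field_derivative \<beta> $ 2) (at \<tau>)"
    by (auto intro!: derivative_eq_intros)
  show ?case
    unfolding eval2_pCons d
    by (rule DERIV_cong[OF DERIV_add[OF 1 DERIV_mult[OF 2 pCons.IH]]])
      (simp add: eval2_add eval2_smult eval2_pCons dir_deriv_def algebra_simps)
qed simp

text \<open>The formal derivative agrees with the analytic one along the line, so uniqueness of
  derivatives turns the iterates into derivatives of \<open>q\<close>, and at \<open>x\<close> into
  a Taylor coefficient.\<close>

lemma eval2_dir_deriv_iter: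
  assumes "\<And>\<tau>. eval2 p (x + \<tau> *s \<beta>) = poly q \<tau>"
  shows "eval2 ((dir_deriv \<beta> ^^ r) p) x = fact r * coeff q r"
proof -
  have line: "eval2 ((dir_deriv \<beta> ^^ r) p) (x + \<tau> *s \<beta>) = poly ((pderiv ^^ r) q) \<tau>" for \<tau> r
  proof (induction r arbitrary: \<tau>)
    case (Suc r)
    have "((\<lambda>\<tau>. poly ((pderiv ^^ r) q) \<tau>) has_field_derivative
        eval2 ((dir_deriv \<beta> ^^ Suc r) p) (x + \<tau> *s \<beta>)) (at \<tau>)"
      using DERIV_eval2_line[of "(dir_deriv \<beta> ^^ r) p" x \<beta> \<tau>] by (simp add: Suc)
    from DERIV_unique[OF this poly_DERIV] show ?case by simp
  qed (simp add: assms)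
  have "eval2 ((dir_deriv \<beta> ^^ r) p) x = coeff ((pderiv ^^ r) q) 0"
    using line[of r 0] by (simp add: poly_0_coeff_0)
  also have "\<dots> = fact r * coeff q r"
    by (simp add: coeff_higher_pderiv pochhammer_fact)
  finally show ?thesis .
qed

text \<open>Each derivative lowers the degree by one. The form \<open>i + j + r = k\<close>, without
  truncated subtraction, also covers \<open>r > k\<close>, where all coefficients vanish.\<close>

lemma coeff_dir_deriv_iter_homogeneous:
  assumes "p \<in> homogeneous k" "coeff (coeff ((dir_deriv \<beta> ^^ r) p) j) i \<noteq> 0"
  shows "i + j + r = k"
  using assms(2)
proof (induction r arbitrary: i j)
  case 0
  then show ?case using assms(1) by (auto simp: homogeneous_def)
next
  case (Suc r)
  then have "coeff (coeff ((dir_deriv \<beta> ^^ r) p) j) (Suc i) \<noteq> 0 \<or>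
      coeff (coeff ((dir_deriv \<beta> ^^ r) p) (Suc j)) i \<noteq> 0"
    by (auto simp: coeff_dir_deriv)
  then show ?case using Suc.IH[of j "Suc i"] Suc.IH[of "Suc j" i] by auto
qed

lemma eval2_altdef:
  "eval2 p x = (\<Sum>j\<le>degree p. \<Sum>i\<le>degree (coeff p j). coeff (coeff p j) i * x $ 1 ^ i * x $ 2 ^ j)"
proof -
  have "eval2 p x = (\<Sum>j\<le>degree p. poly (coeff p j) (x $ 1) * x $ 2 ^ j)"
    unfolding eval2_def poly_altdef[of p] by (simp add: poly_sum)
  then show ?thesis
    by (simp only: poly_altdef[of "coeff p _"] sum_distrib_right)
qed

lemma eval2_scale_eq_0:
  assumes "p \<in> homogeneous k" "eval2 ((dir_deriv \<beta> ^^ r) p) x = 0"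
  shows "eval2 ((dir_deriv \<beta> ^^ r) p) (c *s x) = 0"
proof -
  let ?q = "(dir_deriv \<beta> ^^ r) p"
  have "coeff (coeff ?q j) i * (c *s x) $ 1 ^ i * (c *s x) $ 2 ^ j
      = c ^ (k - r) * (coeff (coeff ?q j) i * x $ 1 ^ i * x $ 2 ^ j)" for i j
  proof (cases "coeff (coeff ?q j) i = 0")
    case False
    from coeff_dir_deriv_iter_homogeneous[OF assms(1) this] have "k - r = i + j" by simp
    then show ?thesis by (simp add: power_mult_distrib power_add)
  qed simp
  then have "eval2 ?q (c *s x) = c ^ (k - r) * eval2 ?q x"
    unfolding eval2_altdef sum_distrib_left by (intro sum.cong refl)
  then show ?thesis using assms(2) by simp
qed

text \<open>The derivative is homogeneous and the line is spanned by \<open>perp \<beta>\<close>, so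
  one value decides. Each condition thereby becomes a single linear functional.\<close>

lemma quasi_invariant_condition_iff:
  assumes "p \<in> homogeneous k" "bil \<beta> \<beta> \<noteq> 0"
  shows "(\<forall>x. bil \<beta> x = 0 \<longrightarrow> eval2 ((dir_deriv \<beta> ^^ r) p) x = 0) \<longleftrightarrow>
    eval2 ((dir_deriv \<beta> ^^ r) p) (perp \<beta>) = 0"
  using eval2_scale_eq_0[OF assms(1)] unfolding orthogonal_iff_perp[OF assms(2)]
  by (metis vector_smult_lid)

section \<open>Binary forms in isotropic coordinates\<close>

lemma poly_altdef_le:
  fixes x :: complex
  assumes "degree h \<le> n"
  shows "poly h x = (\<Sum>a\<le>n. coeff h a * x ^ a)"
  unfolding poly_altdef using assms by (intro sum.mono_neutral_left) (auto simp: coeff_eq_0)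

text \<open>The two linear factors are \<open>x\<^sub>1 + \<i> x\<^sub>2\<close> and
  \<open>x\<^sub>1 - \<i> x\<^sub>2\<close>, so \<open>g\<close> lists coefficients in isotropic
  coordinates.\<close>

definition binary_form :: "nat \<Rightarrow> (nat \<Rightarrow> complex) \<Rightarrow> poly2" where
  "binary_form k g = (\<Sum>a\<le>k. smult [:g a:] ([:[:0, 1:], [:\<i>:]:] ^ a * [:[:0, 1:], [:- \<i>:]:] ^ (k - a)))"

text \<open>The same form with univariate polynomials in place of the isotropic coordinates, as
  happens on restriction to a line.\<close>

definition homogenize :: "nat \<Rightarrow> (nat \<Rightarrow> complex) \<Rightarrow> complex poly \<Rightarrow> complex poly \<Rightarrow> complex poly" where
  "homogenize k g X Y = (\<Sum>a\<le>k. smult (g a) (X ^ a * Y ^ (k - a)))"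

lemma homogeneous_mult:
  assumes "p \<in> homogeneous a" "q \<in> homogeneous b"
  shows "p * q \<in> homogeneous (a + b)"
  unfolding homogeneous_def
proof (intro CollectI allI impI)
  fix i j assume "coeff (coeff (p * q) j) i \<noteq> 0"
  then have "(\<Sum>j'\<le>j. \<Sum>i'\<le>i. coeff (coeff p j') i' * coeff (coeff q (j - j')) (i - i')) \<noteq> 0"
    by (simp add: coeff_mult coeff_sum)
  then obtain j' i' where "j' \<le> j" "i' \<le> i" "coeff (coeff p j') i' * coeff (coeff q (j - j')) (i - i') \<noteq> 0"
    by (auto elim!: sum.not_neutral_contains_not_neutral)
  with assms show "i + j = a + b" by (fastforce simp: homogeneous_def)
qed

lemma homogeneous_power:
  assumes "p \<in> homogeneous 1" shows "p ^ a \<in> homogeneous a"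
proof (induction a)
  case (Suc a)
  then show ?case using homogeneous_mult[OF assms, of "p ^ a" a] by simp
qed (auto simp: homogeneous_def one_pCons coeff_pCons split: nat.splits)

lemma linear_form_homogeneous: "[:[:0, 1:], [:c:]:] \<in> homogeneous 1"
  by (auto simp: homogeneous_def coeff_pCons split: nat.splits)

lemma binary_form_homogeneous: "binary_form k g \<in> homogeneous k"
proof -
  have mem: "p ^ a * q ^ (k - a) \<in> homogeneous k"
    if "a \<le> k" "p \<in> homogeneous 1" "q \<in> homogeneous 1" for a p q
    using homogeneous_mult[OF homogeneous_power homogeneous_power, OF that(2,3), of a "k - a"] that(1)
    by simp
  then show ?thesis
    unfolding binary_form_def
    by (intro poly2.subspace_sum[OF subspace_homogeneous] poly2.subspace_scale[OF subspace_homogeneous]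
        mem linear_form_homogeneous) auto
qed

lemma eval2_binary_form_line:
  "eval2 (binary_form k g) (perp \<beta> + \<tau> *s \<beta>) =
    poly (homogenize k g [:\<i> * bplus \<beta>, bplus \<beta>:] [:- \<i> * bminus \<beta>, bminus \<beta>:]) \<tau>"
proof -
  have "eval2 [:[:0, 1:], [:\<i>:]:] (perp \<beta> + \<tau> *s \<beta>) = poly [:\<i> * bplus \<beta>, bplus \<beta>:] \<tau>"
    "eval2 [:[:0, 1:], [:- \<i>:]:] (perp \<beta> + \<tau> *s \<beta>) = poly [:- \<i> * bminus \<beta>, bminus \<beta>:] \<tau>"
    by (simp_all add: eval2_pCons bplus_def bminus_def perp_def algebra_simps)
  then show ?thesis
    unfolding binary_form_def homogenize_def
    by (simp only: eval2_sum eval2_scale eval2_mult eval2_power poly_sum poly_smult poly_mult poly_power)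
qed

text \<open>As \<open>c\<close> is a square root of -1, the polynomial \<open>[:1, 0, 1:]\<close>
  factors as \<open>(\<tau> - c) (\<tau> + c)\<close>, and the base of the power is
  \<open>b (\<tau> + c)\<close>.\<close>

lemma pderiv_power_linear:
  fixes b c :: complex
  assumes "c * c = - 1"
  shows "[:1, 0, 1:] * pderiv ([:c * b, b:] ^ a) = smult (of_nat a) ([:- c, 1:] * [:c * b, b:] ^ a)"
proof (induction a)
  case (Suc a)
  let ?X = "[:c * b, b:]"
  have 1: "[:1, 0, 1:] * pderiv ?X = [:- c, 1:] * ?X"
  proof -
    have "c * b * c = - b" using assms by algebra
    then show ?thesis by (simp add: pderiv_pCons)
  qed
  have "[:1, 0, 1:] * pderiv (?X ^ Suc a) = ?X * ([:1, 0, 1:] * pderiv (?X ^ a)) + ?X ^ a * ([:1, 0, 1:] * pderiv ?X)"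
    unfolding power_Suc pderiv_mult by algebra
  also have "\<dots> = smult (of_nat (Suc a)) ([:- c, 1:] * ?X ^ Suc a)"
    unfolding 1 Suc.IH
    by (simp add: algebra_simps smult_add_left del: mult_pCons_left mult_pCons_right)
  finally show ?case .
qed simp

lemma smult_sum2: "smult c (sum f A) = (\<Sum>a\<in>A. smult c (f a))"
  by (induction A rule: infinite_finite_induct) (simp_all add: smult_add_right)

text \<open>
  With \<open>q(\<tau>) = p(perp \<beta> + \<tau> \<beta>)\<close>, Euler's identity for the form \<open>p\<close> expresses its angular derivative on
  this line through \<open>q\<close> and \<open>q'\<close>.
\<close>

lemma pderiv_homogenize:
  assumes h: "\<And>a. a \<le> k \<Longrightarrow> h a = (2 * of_nat a - of_nat k) * g a"
  shows "[:1, 0, 1:] * pderiv (homogenize k g [:\<i> * b, b:] [:- \<i> * c, c:])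
      - smult (of_nat k) ([:0, 1:] * homogenize k g [:\<i> * b, b:] [:- \<i> * c, c:])
    = smult (- \<i>) (homogenize k h [:\<i> * b, b:] [:- \<i> * c, c:])"
proof -
  let ?X = "[:\<i> * b, b:]" and ?Y = "[:- \<i> * c, c:]"
  \<comment> \<open>The operator acts on each product as a scalar, because \<open>a (\<tau> - \<i>)
    + e (\<tau> + \<i>) - (a + e) \<tau> = - \<i> (a - e)\<close>.\<close>
  have monomial: "[:1, 0, 1:] * pderiv (?X ^ a * ?Y ^ e) - smult (of_nat (a + e)) ([:0, 1:] * (?X ^ a * ?Y ^ e))
      = smult (- \<i> * (of_nat a - of_nat e)) (?X ^ a * ?Y ^ e)" for a e
  proof -
    have "[:1, 0, 1:] * pderiv (?X ^ a * ?Y ^ e) =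
        ?X ^ a * ([:1, 0, 1:] * pderiv (?Y ^ e)) + ?Y ^ e * ([:1, 0, 1:] * pderiv (?X ^ a))"
      unfolding pderiv_mult by algebra
    also have "\<dots> = ?X ^ a * smult (of_nat e) ([:\<i>, 1:] * ?Y ^ e) + ?Y ^ e * smult (of_nat a) ([:- \<i>, 1:] * ?X ^ a)"
      using pderiv_power_linear[of "- \<i>" c e] pderiv_power_linear[of \<i> b a] by simp
    finally have *: "[:1, 0, 1:] * pderiv (?X ^ a * ?Y ^ e) =
        ?X ^ a * smult (of_nat e) ([:\<i>, 1:] * ?Y ^ e) + ?Y ^ e * smult (of_nat a) ([:- \<i>, 1:] * ?X ^ a)" .
    have "[:1, 0, 1:] * pderiv (?X ^ a * ?Y ^ e) - smult (of_nat (a + e)) ([:0, 1:] * (?X ^ a * ?Y ^ e))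
      = (smult (of_nat e) [:\<i>, 1:] + smult (of_nat a) [:- \<i>, 1:] - smult (of_nat (a + e)) [:0, 1:])
        * (?X ^ a * ?Y ^ e)"
      unfolding * by (simp only: algebra_simps mult_smult_left mult_smult_right)
    also have "smult (of_nat e) [:\<i>, 1:] + smult (of_nat a) [:- \<i>, 1:] - smult (of_nat (a + e)) [:0, 1:]
        = [:- \<i> * (of_nat a - of_nat e):]"
      by (simp add: algebra_simps)
    finally show ?thesis by simp
  qed
  have "[:1, 0, 1:] * pderiv (\<Sum>a\<le>k. smult (g a) (?X ^ a * ?Y ^ (k - a)))
      - smult (of_nat k) ([:0, 1:] * (\<Sum>a\<le>k. smult (g a) (?X ^ a * ?Y ^ (k - a))))
    = (\<Sum>a\<le>k. smult (g a) ([:1, 0, 1:] * pderiv (?X ^ a * ?Y ^ (k - a))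
        - smult (of_nat k) ([:0, 1:] * (?X ^ a * ?Y ^ (k - a)))))"
    by (simp only: higher_pderiv_sum[of 1, simplified] pderiv_smult sum_distrib_left mult_smult_right smult_sum2
        sum_subtractf smult_diff_right smult_smult mult.commute)
  also have "\<dots> = (\<Sum>a\<le>k. smult (g a) (smult (- \<i> * (2 * of_nat a - of_nat k)) (?X ^ a * ?Y ^ (k - a))))"
  proof (intro sum.cong refl arg_cong2[of _ _ _ _ smult])
    fix a assume "a \<in> {..k}"
    then have a: "a + (k - a) = k" "of_nat (k - a) = (of_nat k - of_nat a :: complex)"
      by (auto simp: of_nat_diff)
    show "[:1, 0, 1:] * pderiv (?X ^ a * ?Y ^ (k - a)) - smult (of_nat k) ([:0, 1:] * (?X ^ a * ?Y ^ (k - a)))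
        = smult (- \<i> * (2 * of_nat a - of_nat k)) (?X ^ a * ?Y ^ (k - a))"
      using monomial[of a "k - a"] unfolding a by (simp add: algebra_simps)
  qed
  also have "\<dots> = smult (- \<i>) (\<Sum>a\<le>k. smult (h a) (?X ^ a * ?Y ^ (k - a)))"
    unfolding smult_sum2 by (intro sum.cong refl) (simp add: h algebra_simps)
  finally show ?thesis by (simp only: homogenize_def)
qed

text \<open>Comparing coefficients of even index \<open>2 * r\<close> involves \<open>q\<close> only
  at the two neighbouring odd indices. While these coefficients of \<open>H\<close> vanish, so do
  the odd ones of \<open>q\<close>, and the next one can be read off.\<close>

lemma coeff_odd_ode:
  fixes q H :: "complex poly"
  assumes ode: "[:1, 0, 1:] * pderiv q - smult c ([:0, 1:] * q) = H"
    and H: "\<And>r. r < s \<Longrightarrow> coeff H (2 * r) = 0"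
  shows "of_nat (2 * s + 1) * coeff q (2 * s + 1) = coeff H (2 * s)"
  using H
proof (induction s)
  case 0
  then show ?case using ode by (auto simp: coeff_pderiv)
next
  case (Suc s)
  then have "of_nat (2 * s + 1) * coeff q (2 * s + 1) = 0" by simp
  then have q: "coeff q (2 * s + 1) = 0"
    by (metis mult_eq_0_iff of_nat_eq_0_iff add_is_0 one_neq_zero)
  have "coeff H (Suc (Suc (2 * s))) = of_nat (2 * s + 3) * coeff q (2 * s + 3)"
    using q by (simp add: ode[symmetric] coeff_pderiv eval_nat_numeral del: of_nat_Suc)
  then show ?case by (simp add: eval_nat_numeral)
qed

text \<open>Homogenization is multiplicative: the factor \<open>x - \<zeta>\<close> becomes
  \<open>X - \<zeta> Y\<close> and raises the formal degree by one.\<close>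

lemma homogenize_linear_factor:
  assumes "degree h \<le> k"
  shows "homogenize (Suc k) (coeff ([:- \<zeta>, 1:] * h)) X Y = (X - smult \<zeta> Y) * homogenize k (coeff h) X Y"
proof -
  have "homogenize (Suc k) (coeff ([:- \<zeta>, 1:] * h)) X Y =
      (\<Sum>a\<le>Suc k. smult (- \<zeta> * coeff h a) (X ^ a * Y ^ (Suc k - a)))
      + (\<Sum>a\<le>Suc k. smult (coeff (pCons 0 h) a) (X ^ a * Y ^ (Suc k - a)))"
    unfolding homogenize_def sum.distrib[symmetric]
    by (intro sum.cong refl) (simp add: smult_diff_left)
  also have "(\<Sum>a\<le>Suc k. smult (- \<zeta> * coeff h a) (X ^ a * Y ^ (Suc k - a)))
      = (\<Sum>a\<le>k. - smult \<zeta> Y * smult (coeff h a) (X ^ a * Y ^ (k - a)))"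
    using assms by (auto simp: coeff_eq_0 Suc_diff_le algebra_simps intro!: sum.cong)
  also have "(\<Sum>a\<le>Suc k. smult (coeff (pCons 0 h) a) (X ^ a * Y ^ (Suc k - a)))
      = (\<Sum>a\<le>k. X * smult (coeff h a) (X ^ a * Y ^ (k - a)))"
    by (subst sum.atMost_Suc_shift) (auto simp: algebra_simps)
  finally have *: "homogenize (Suc k) (coeff ([:- \<zeta>, 1:] * h)) X Y =
      (\<Sum>a\<le>k. - smult \<zeta> Y * smult (coeff h a) (X ^ a * Y ^ (k - a)))
      + (\<Sum>a\<le>k. X * smult (coeff h a) (X ^ a * Y ^ (k - a)))" .
  show ?thesis
    by (subst *) (simp only: homogenize_def left_diff_distrib sum_distrib_left mult_minus_left sum_negf uminus_add_conv_diff
        sum_subtractf)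
qed

lemma homogenize_power_factor:
  assumes "degree h + r \<le> k"
  shows "homogenize k (coeff ([:- \<zeta>, 1:] ^ r * h)) X Y = (X - smult \<zeta> Y) ^ r * homogenize (k - r) (coeff h) X Y"
  using assms
proof (induction r arbitrary: k)
  case (Suc r)
  then obtain k' where k: "k = Suc k'" "degree h + r \<le> k'" by (cases k) auto
  have "degree ([:- \<zeta>, 1:] ^ r * h) \<le> k'"
    using k(2) degree_mult_le[of "[:- \<zeta>, 1:] ^ r" h] degree_linear_power[of "- \<zeta>" r] by linarith
  then show ?case
    using homogenize_linear_factor[of "[:- \<zeta>, 1:] ^ r * h" k' \<zeta> X Y] Suc.IH[OF k(2)] k(1)
    by (simp add: mult.assoc del: mult_pCons_left)
qed simp

text \<open>The value of \<open>(x\<^sub>1 + \<i> x\<^sub>2) / (x\<^sub>1 - \<i> x\<^sub>2)\<close> on the line orthogonal to \<open>\<beta>\<close>.\<close>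

definition line_root :: "complex^2 \<Rightarrow> complex" where
  "line_root \<beta> = - bplus \<beta> / bminus \<beta>"

text \<open>For \<open>\<zeta> = line_root \<beta>\<close> the factor \<open>X - \<zeta> Y\<close>
  is \<open>2 * bplus \<beta>\<close> times the variable, so a root of order \<open>r\<close> at
  \<open>\<zeta>\<close> becomes a zero of order at least \<open>r\<close> at 0. At 0 also
  \<open>X = \<zeta> Y\<close>, which evaluates the cofactor.\<close>

lemma homogenize_line_root:
  assumes "bil \<beta> \<beta> \<noteq> 0" "degree h + r \<le> k"
  defines "H \<equiv> homogenize k (coeff ([:- line_root \<beta>, 1:] ^ r * h)) [:\<i> * bplus \<beta>, bplus \<beta>:] [:- \<i> * bminus \<beta>, bminus \<beta>:]"
  shows "j < r \<Longrightarrow> coeff H j = 0"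
    and "coeff H r = (2 * bplus \<beta>) ^ r * (- \<i> * bminus \<beta>) ^ (k - r) * poly h (line_root \<beta>)"
proof -
  let ?X = "[:\<i> * bplus \<beta>, bplus \<beta>:]" and ?Y = "[:- \<i> * bminus \<beta>, bminus \<beta>:]"
  have nz: "bminus \<beta> \<noteq> 0"
    using assms(1) bplus_bminus[of \<beta>] by auto
  have "?X - smult (line_root \<beta>) ?Y = monom (2 * bplus \<beta>) 1"
    using nz by (simp add: line_root_def monom_Suc monom_0)
  then have H: "H = monom ((2 * bplus \<beta>) ^ r) r * homogenize (k - r) (coeff h) ?X ?Y"
    unfolding H_def homogenize_power_factor[OF assms(2)] by (simp add: monom_power)
  show "j < r \<Longrightarrow> coeff H j = 0"
    by (simp add: H coeff_monom_mult)
  have "coeff (homogenize (k - r) (coeff h) ?X ?Y) 0 =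
      (\<Sum>a\<le>k - r. coeff h a * ((\<i> * bplus \<beta>) ^ a * (- \<i> * bminus \<beta>) ^ (k - r - a)))"
    by (simp add: homogenize_def poly_sum flip: poly_0_coeff_0)
  also have "\<dots> = (\<Sum>a\<le>k - r. (- \<i> * bminus \<beta>) ^ (k - r) * (coeff h a * line_root \<beta> ^ a))"
  proof (intro sum.cong refl)
    fix a assume "a \<in> {..k - r}"
    then have "(- \<i> * bminus \<beta>) ^ (k - r) = (- \<i> * bminus \<beta>) ^ (k - r - a) * (- \<i> * bminus \<beta>) ^ a"
      by (simp flip: power_add del: diff_diff_left)
    moreover have "\<i> * bplus \<beta> = (- \<i> * bminus \<beta>) * line_root \<beta>"
      using nz by (simp add: line_root_def)
    ultimately show "coeff h a * ((\<i> * bplus \<beta>) ^ a * (- \<i> * bminus \<beta>) ^ (k - r - a)) =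
        (- \<i> * bminus \<beta>) ^ (k - r) * (coeff h a * line_root \<beta> ^ a)"
      by (simp only: power_mult_distrib mult_ac)
  qed
  also have "\<dots> = (- \<i> * bminus \<beta>) ^ (k - r) * poly h (line_root \<beta>)"
    using assms(2) by (simp add: sum_distrib_left poly_altdef_le[of h "k - r"])
  finally show "coeff H r = (2 * bplus \<beta>) ^ r * (- \<i> * bminus \<beta>) ^ (k - r) * poly h (line_root \<beta>)"
    by (simp add: H coeff_monom_mult)
qed


text \<open>
  The angular derivative multiplies the coefficient of index \<open>a\<close> by \<open>2 * a - k\<close> (up to a constant), so
  this is a preimage of \<open>h\<close>. For \<open>2 * a = k\<close> the quotient is 0, which is harmless only if the middle
  coefficient of \<open>h\<close> vanishes.
\<close>

definition lift_form :: "nat \<Rightarrow> complex poly \<Rightarrow> poly2" where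
  "lift_form k h = binary_form k (\<lambda>a. coeff h a / (2 * of_nat a - of_nat k))"

text \<open>A root of order \<open>r\<close> makes the restricted angular derivative vanish to order
  \<open>r\<close>, and the differential equation passes this on to the odd Taylor coefficients of
  the lifted form. If the order is exactly \<open>2 * s\<close>, the derivative of order
  \<open>2 * s + 1\<close> is the first odd one that survives.\<close>

lemma lift_form_conditions:
  assumes \<beta>: "bil \<beta> \<beta> \<noteq> 0"
    and mid: "\<And>a. 2 * a = k \<Longrightarrow> coeff ([:- line_root \<beta>, 1:] ^ r * h) a = 0"
    and deg: "degree h + r \<le> k"
  defines "p \<equiv> lift_form k ([:- line_root \<beta>, 1:] ^ r * h)"
  shows "2 * s < r \<Longrightarrow> eval2 ((dir_deriv \<beta> ^^ (2 * s + 1)) p) (perp \<beta>) = 0"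
    and "r = 2 * s \<Longrightarrow> poly h (line_root \<beta>) \<noteq> 0 \<Longrightarrow> eval2 ((dir_deriv \<beta> ^^ (2 * s + 1)) p) (perp \<beta>) \<noteq> 0"
proof -
  let ?h = "coeff ([:- line_root \<beta>, 1:] ^ r * h)"
  let ?X = "[:\<i> * bplus \<beta>, bplus \<beta>:]" and ?Y = "[:- \<i> * bminus \<beta>, bminus \<beta>:]"
  define g where "g = (\<lambda>a. ?h a / (2 * of_nat a - of_nat k))"
  define q where "q = homogenize k g ?X ?Y"
  define H where "H = homogenize k ?h ?X ?Y"
  have "?h a = (2 * of_nat a - of_nat k) * g a" for a
  proof (cases "2 * a = k")
    case False
    then have "(2 * of_nat a - of_nat k :: complex) \<noteq> 0"
      by (metis eq_iff_diff_eq_0 of_nat_eq_iff of_nat_mult of_nat_numeral)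
    then show ?thesis by (simp add: g_def)
  qed (use mid in auto)
  then have ode: "[:1, 0, 1:] * pderiv q - smult (of_nat k) ([:0, 1:] * q) = smult (- \<i>) H"
    unfolding q_def H_def by (intro pderiv_homogenize)
  have ev: "eval2 ((dir_deriv \<beta> ^^ t) p) (perp \<beta>) = fact t * coeff q t" for t
    unfolding p_def lift_form_def
    by (rule eval2_dir_deriv_iter) (simp only: eval2_binary_form_line q_def g_def)
  note H = homogenize_line_root[OF \<beta> deg, folded H_def]
  have nz: "bplus \<beta> \<noteq> 0" "bminus \<beta> \<noteq> 0"
    using \<beta> bplus_bminus[of \<beta>] by auto
  have coeff: "of_nat (2 * s + 1) * coeff q (2 * s + 1) = - \<i> * coeff H (2 * s)" if "2 * s \<le> r"
    using coeff_odd_ode[OF ode, of s] that H(1) by simp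
  show "eval2 ((dir_deriv \<beta> ^^ (2 * s + 1)) p) (perp \<beta>) = 0" if "2 * s < r"
  proof -
    have "of_nat (2 * s + 1) * coeff q (2 * s + 1) = 0"
      using coeff that H(1)[OF that] by simp
    then have "coeff q (2 * s + 1) = 0"
      by (metis mult_eq_0_iff of_nat_eq_0_iff add_is_0 one_neq_zero)
    then show ?thesis unfolding ev by simp
  qed
  show "eval2 ((dir_deriv \<beta> ^^ (2 * s + 1)) p) (perp \<beta>) \<noteq> 0" if "r = 2 * s" "poly h (line_root \<beta>) \<noteq> 0"
  proof -
    have "of_nat (2 * s + 1) * coeff q (2 * s + 1) \<noteq> 0"
      using coeff that nz H(2) by simp
    then have "coeff q (2 * s + 1) \<noteq> 0" by auto
    then show ?thesis unfolding ev by (simp del: fact_Suc)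
  qed
qed

lemma lift_form_homogeneous: "lift_form k h \<in> homogeneous k"
  by (simp add: lift_form_def binary_form_homogeneous)

section \<open>Independence of the quasi-invariance conditions\<close>

lemma lift_form_vanishes:
  assumes \<beta>: "bil \<beta> \<beta> \<noteq> 0" and deg: "degree w \<le> k" "w \<noteq> 0"
    and mid: "\<And>a. 2 * a = k \<Longrightarrow> coeff w a = 0"
    and dvd: "[:- line_root \<beta>, 1:] ^ r dvd w" and s: "2 * s < r"
  shows "eval2 ((dir_deriv \<beta> ^^ (2 * s + 1)) (lift_form k w)) (perp \<beta>) = 0"
proof -
  obtain h where w: "w = [:- line_root \<beta>, 1:] ^ r * h" using dvd by blast
  have "degree h + r \<le> k"
    using deg by (auto simp: w degree_mult_eq degree_linear_power)
  then show ?thesis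
    using lift_form_conditions(1)[OF \<beta> _ _ s, of k h] mid unfolding w by blast
qed

lemma lift_form_nonvanishing:
  assumes \<beta>: "bil \<beta> \<beta> \<noteq> 0" and deg: "degree w \<le> k"
    and mid: "\<And>a. 2 * a = k \<Longrightarrow> coeff w a = 0"
    and dvd: "[:- line_root \<beta>, 1:] ^ (2 * s) dvd w"
    and ndvd: "\<not> [:- line_root \<beta>, 1:] ^ (2 * s + 1) dvd w"
  shows "eval2 ((dir_deriv \<beta> ^^ (2 * s + 1)) (lift_form k w)) (perp \<beta>) \<noteq> 0"
proof -
  obtain h where w: "w = [:- line_root \<beta>, 1:] ^ (2 * s) * h" using dvd by blast
  have "h \<noteq> 0" using ndvd w by auto
  then have 1: "degree h + 2 * s \<le> k"
    using deg by (auto simp: w degree_mult_eq degree_linear_power)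
  have "poly h (line_root \<beta>) \<noteq> 0"
  proof
    assume "poly h (line_root \<beta>) = 0"
    then have "[:- line_root \<beta>, 1:] dvd h" by (simp add: poly_eq_0_iff_dvd)
    then have "[:- line_root \<beta>, 1:] ^ (2 * s) * [:- line_root \<beta>, 1:] dvd w"
      unfolding w by (rule mult_dvd_mono[OF dvd_refl])
    then show False using ndvd by (simp add: mult.commute del: mult_pCons_left mult_pCons_right)
  qed
  then show ?thesis
    using lift_form_conditions(2)[OF \<beta> _ 1] mid unfolding w by blast
qed

lemma line_root_nonzero:
  assumes "bil \<beta> \<beta> \<noteq> 0" shows "line_root \<beta> \<noteq> 0"
  using assms bplus_bminus[of \<beta>] by (auto simp: line_root_def)

text \<open>The isotropic coordinates determine a vector, and \<open>line_root\<close> is their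
  ratio up to sign.\<close>

lemma line_root_eq_imp_collinear:
  assumes "bil \<beta> \<beta> \<noteq> 0" "bil \<gamma> \<gamma> \<noteq> 0" "line_root \<beta> = line_root \<gamma>"
  shows "\<exists>c. \<beta> = c *s \<gamma>"
proof -
  have nz: "bplus \<gamma> \<noteq> 0" "bminus \<gamma> \<noteq> 0" "bminus \<beta> \<noteq> 0"
    using assms(1,2) bplus_bminus[of \<beta>] bplus_bminus[of \<gamma>] by auto
  define c where "c = bminus \<beta> / bminus \<gamma>"
  have m: "bminus \<beta> = c * bminus \<gamma>" using nz by (simp add: c_def)
  have p: "bplus \<beta> = c * bplus \<gamma>" using nz assms(3) by (simp add: c_def line_root_def field_simps)
  have "2 * (\<beta> $ 1) = c * (2 * \<gamma> $ 1)" "2 * \<i> * \<beta> $ 2 = c * (2 * \<i> * \<gamma> $ 2)"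
    using m p unfolding bplus_def bminus_def by algebra+
  then have "\<beta> = c *s \<gamma>" by (simp add: vec_eq_iff forall_2)
  then show ?thesis ..
qed

text \<open>
  The \<open>m + n\<close> conditions are numbered by \<open>t\<close>: the first \<open>m\<close> of them concern the vector 0 and
  derivatives of order \<open>2 * t + 1\<close>.
\<close>

definition cond_vec :: "nat \<Rightarrow> nat \<Rightarrow> nat" where
  "cond_vec m t = (if t < m then 0 else t - m + 1)"

definition cond_ord :: "nat \<Rightarrow> nat \<Rightarrow> nat" where
  "cond_ord m t = (if t < m then t else 0)"

definition cond :: "nat \<Rightarrow> (nat \<Rightarrow> complex^2) \<Rightarrow> nat \<Rightarrow> poly2 \<Rightarrow> complex" where
  "cond m \<beta> t p =
     eval2 ((dir_deriv (\<beta> (cond_vec m t)) ^^ (2 * cond_ord m t + 1)) p) (perp (\<beta> (cond_vec m t)))"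

lemma linear_cond: "Vector_Spaces.linear (\<lambda>c (p::poly2). smult [:c:] p) (*) (cond m \<beta> t)"
  by (rule linear_poly2I)
    (simp_all only: cond_def dir_deriv_iter_add dir_deriv_iter_smult eval2_add eval2_scale)

lemma quasi_invariants_homogeneous_eq:
  assumes "admissible_vectors n \<beta>"
  shows "quasi_invariants (config m n \<beta>) \<inter> homogeneous k = {p \<in> homogeneous k. \<forall>t<m + n. cond m \<beta> t p = 0}"
proof -
  have iso: "bil (\<beta> i) (\<beta> i) \<noteq> 0" if "i \<le> n" for i
    using assms that by (simp add: admissible_vectors_def)
  define C where "C = (\<lambda>i r p. eval2 ((dir_deriv (\<beta> i) ^^ r) p) (perp (\<beta> i)) = 0)"
  have "p \<in> quasi_invariants (config m n \<beta>) \<longleftrightarrow> (\<forall>t<m + n. cond m \<beta> t p = 0)"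
    if p: "p \<in> homogeneous k" for p
  proof -
    have "p \<in> quasi_invariants (config m n \<beta>) \<longleftrightarrow>
        (\<forall>s\<in>{1..m}. C 0 (2 * s - 1) p) \<and> (\<forall>i\<in>{1..n}. C i 1 p)"
      unfolding quasi_invariants_def config_def C_def
      using quasi_invariant_condition_iff[OF p iso] by fastforce
    also have "(\<forall>s\<in>{1..m}. C 0 (2 * s - 1) p) \<longleftrightarrow> (\<forall>t<m. cond m \<beta> t p = 0)"
    proof -
      \<comment> \<open>The shift \<open>s = Suc t\<close> turns the order \<open>2 * s - 1\<close>
        into \<open>2 * t + 1\<close>.\<close>
      have "(\<forall>s\<in>{1..m}. C 0 (2 * s - 1) p) \<longleftrightarrow> (\<forall>t<m. C 0 (2 * Suc t - 1) p)"
        by (metis atLeastAtMost_iff Suc_le_eq Suc_pred' One_nat_def zero_less_Suc le_simps(3))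
      then show ?thesis by (simp add: C_def cond_def cond_vec_def cond_ord_def)
    qed
    also have "(\<forall>i\<in>{1..n}. C i 1 p) \<longleftrightarrow> (\<forall>t\<in>{m..<m + n}. cond m \<beta> t p = 0)"
    proof -
      have "{1..n} = (\<lambda>t. t - m + 1) ` {m..<m + n}"
      proof (intro equalityI subsetI)
        fix i assume "i \<in> {1..n}"
        then show "i \<in> (\<lambda>t. t - m + 1) ` {m..<m + n}"
          by (intro image_eqI[of _ _ "i + m - 1"]) auto
      qed auto
      then show ?thesis by (simp add: C_def cond_def cond_vec_def cond_ord_def del: image_add_atLeastLessThan')
    qed
    finally show ?thesis by (auto simp: not_le)
  qed
  then show ?thesis by auto
qed

section \<open>Univariate polynomials with prescribed roots at the lines\<close>

definition multip :: "nat \<Rightarrow> nat \<Rightarrow> nat" where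
  "multip m i = (if i = 0 then m else 1)"

text \<open>A root of order \<open>2 * multip m i - 1\<close> is enough for all conditions on the
  vector \<open>i\<close>, whose derivative orders are \<open>2 * s + 1\<close> with
  \<open>s < multip m i\<close>.\<close>

definition full_poly :: "nat \<Rightarrow> nat \<Rightarrow> (nat \<Rightarrow> complex) \<Rightarrow> complex poly" where
  "full_poly m n \<zeta> = (\<Prod>i\<le>n. [:- \<zeta> i, 1:] ^ (2 * multip m i - 1))"

lemma cond_vec_le: "t < m + n \<Longrightarrow> cond_vec m t \<le> n"
  by (auto simp: cond_vec_def)

lemma cond_ord_less: "t < m + n \<Longrightarrow> 2 * cond_ord m t + 1 \<le> 2 * multip m (cond_vec m t) - 1"
  by (auto simp: cond_vec_def cond_ord_def multip_def)

text \<open>The lift of \<open>w t\<close> satisfies all conditions on the other vectors and those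
  of lower order on its own vector, but not condition \<open>t\<close>. The conditions are thus
  triangular and cut \<open>m + n\<close> off the dimension \<open>k + 1\<close>.\<close>

lemma dim_quasi_invariants_triangular:
  assumes adm: "admissible_vectors n \<beta>"
    and deg: "\<And>t. t < m + n \<Longrightarrow> degree (w t) \<le> k"
    and mid: "\<And>t a. t < m + n \<Longrightarrow> 2 * a = k \<Longrightarrow> coeff (w t) a = 0"
    and other: "\<And>t j. t < m + n \<Longrightarrow> j \<le> n \<Longrightarrow> j \<noteq> cond_vec m t \<Longrightarrow>
        [:- line_root (\<beta> j), 1:] ^ (2 * multip m j - 1) dvd w t"
    and dvd: "\<And>t. t < m + n \<Longrightarrow> [:- line_root (\<beta> (cond_vec m t)), 1:] ^ (2 * cond_ord m t) dvd w t"
    and ndvd: "\<And>t. t < m + n \<Longrightarrow> \<not> [:- line_root (\<beta> (cond_vec m t)), 1:] ^ (2 * cond_ord m t + 1) dvd w t"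
  shows "poly2.dim (quasi_invariants (config m n \<beta>) \<inter> homogeneous k) + (m + n) = k + 1"
proof -
  have iso: "bil (\<beta> i) (\<beta> i) \<noteq> 0" if "i \<le> n" for i
    using adm that by (simp add: admissible_vectors_def)
  have "cond m \<beta> s (lift_form k (w t)) = 0" if "s < t" "t < m + n" for s t
  proof -
    have w0: "w t \<noteq> 0" using ndvd[OF that(2)] by auto
    have s: "s < m + n" using that by simp
    note van = lift_form_vanishes[OF iso[OF cond_vec_le[OF s]] deg[OF that(2)] w0 mid[OF that(2)]]
    show ?thesis
    proof (cases "cond_vec m s = cond_vec m t")
      case True
      \<comment> \<open>Two different conditions on one vector concern the vector 0, where the
        numbering follows the derivative order.\<close>
      then have "2 * cond_ord m s < 2 * cond_ord m t"
        using that by (auto simp: cond_vec_def cond_ord_def split: if_splits)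
      then show ?thesis unfolding cond_def using dvd[OF that(2)] True by (intro van) auto
    next
      case False
      then show ?thesis
        unfolding cond_def
        using other[OF that(2) cond_vec_le[OF s]] cond_ord_less[OF s] by (intro van) auto
    qed
  qed
  moreover have "cond m \<beta> t (lift_form k (w t)) \<noteq> 0" if "t < m + n" for t
    unfolding cond_def using that
    by (intro lift_form_nonvanishing iso cond_vec_le deg mid dvd ndvd)
  ultimately have "poly2.dim (homogeneous k) =
      poly2.dim {p \<in> homogeneous k. \<forall>t<m + n. cond m \<beta> t p = 0} + (m + n)"
    by (intro poly2.dim_kernel_triangular[OF subspace_homogeneous homogeneous_span,
          where w = "\<lambda>t. lift_form k (w t)"] linear_cond lift_form_homogeneous) auto
  then show ?thesis
    by (simp add: quasi_invariants_homogeneous_eq[OF adm] dim_homogeneous)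
qed

text \<open>This is \<open>full_poly\<close> with the root order at the vector of condition
  \<open>t\<close> lowered to \<open>2 * cond_ord m t\<close>, so that condition \<open>t\<close> is
  the first on its line to fail.\<close>

definition partial_poly :: "nat \<Rightarrow> nat \<Rightarrow> (nat \<Rightarrow> complex) \<Rightarrow> nat \<Rightarrow> complex poly" where
  "partial_poly m n \<zeta> t = [:- \<zeta> (cond_vec m t), 1:] ^ (2 * cond_ord m t) *
     (\<Prod>i\<in>{..n} - {cond_vec m t}. [:- \<zeta> i, 1:] ^ (2 * multip m i - 1))"

lemma degree_full_poly:
  assumes "m \<ge> 1" shows "degree (full_poly m n \<zeta>) + 1 = 2 * m + n"
proof -
  have "degree (full_poly m n \<zeta>) = (\<Sum>i\<le>n. 2 * multip m i - 1)"
    unfolding full_poly_def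
    by (subst degree_prod_eq_sum_degree) (auto simp: degree_linear_power)
  also have "{..n} = insert 0 {1..n}" by auto
  also have "(\<Sum>i\<in>insert 0 {1..n}. 2 * multip m i - 1) = 2 * m - 1 + (\<Sum>i\<in>{1..n}. 1)"
    by (subst sum.insert) (auto simp: multip_def intro!: sum.cong)
  finally show ?thesis using assms by simp
qed

lemma degree_partial_poly:
  assumes "m \<ge> 1" "t < m + n" shows "degree (partial_poly m n \<zeta> t) + 2 \<le> 2 * m + n"
proof -
  let ?c = "cond_vec m t"
  let ?R = "\<Prod>i\<in>{..n} - {?c}. [:- \<zeta> i, 1:] ^ (2 * multip m i - 1)"
  have R0: "?R \<noteq> 0" by simp
  have "full_poly m n \<zeta> = [:- \<zeta> ?c, 1:] ^ (2 * multip m ?c - 1) * ?R"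
    unfolding full_poly_def using cond_vec_le[OF assms(2)] by (subst prod.remove[of _ ?c]) auto
  then have "2 * multip m ?c - 1 + degree ?R + 1 = 2 * m + n"
    using degree_full_poly[OF assms(1), of n \<zeta>] R0 by (simp add: degree_mult_eq degree_linear_power)
  moreover have "degree (partial_poly m n \<zeta> t) = 2 * cond_ord m t + degree ?R"
    unfolding partial_poly_def using R0 by (subst degree_mult_eq) (simp_all add: degree_linear_power)
  ultimately show ?thesis using cond_ord_less[OF assms(2)] by linarith
qed

lemma partial_poly_dvd_other:
  assumes "j \<le> n" "j \<noteq> cond_vec m t"
  shows "[:- \<zeta> j, 1:] ^ (2 * multip m j - 1) dvd partial_poly m n \<zeta> t"
  unfolding partial_poly_def using assms by (intro dvd_mult dvd_prodI) auto

text \<open>The remaining factors do not vanish at this root: the roots are distinct, and the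
  monomial is harmless because the root is non-zero.\<close>

lemma partial_poly_not_dvd:
  assumes inj: "\<And>i. i \<le> n \<Longrightarrow> i \<noteq> cond_vec m t \<Longrightarrow> \<zeta> i \<noteq> \<zeta> (cond_vec m t)"
    and nz: "\<zeta> (cond_vec m t) \<noteq> 0"
  shows "\<not> [:- \<zeta> (cond_vec m t), 1:] ^ (2 * cond_ord m t + 1) dvd monom 1 e * partial_poly m n \<zeta> t"
proof
  let ?c = "cond_vec m t"
  let ?L = "[:- \<zeta> ?c, 1:]"
  let ?R = "\<Prod>i\<in>{..n} - {?c}. [:- \<zeta> i, 1:] ^ (2 * multip m i - 1)"
  assume "?L ^ (2 * cond_ord m t + 1) dvd monom 1 e * partial_poly m n \<zeta> t"
  then have "?L ^ (2 * cond_ord m t) * ?L dvd ?L ^ (2 * cond_ord m t) * (monom 1 e * ?R)"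
    unfolding partial_poly_def power_add power_one_right by (simp only: mult_ac)
  then have "?L dvd monom 1 e * ?R"
    by (subst (asm) dvd_mult_cancel_left) auto
  then have "poly (monom 1 e * ?R) (\<zeta> ?c) = 0"
    by (simp only: poly_eq_0_iff_dvd)
  then show False
    using nz by (auto simp: poly_monom poly_prod) (metis inj)
qed

lemma full_poly_dvd:
  assumes "j \<le> n" shows "[:- \<zeta> j, 1:] ^ (2 * multip m j - 1) dvd full_poly m n \<zeta>"
  unfolding full_poly_def using assms by (intro dvd_prodI) auto

lemma admissible_line_root_inj:
  assumes "admissible_vectors n \<beta>" "i \<le> n" "j \<le> n" "i \<noteq> j"
  shows "line_root (\<beta> i) \<noteq> line_root (\<beta> j)"
  using assms line_root_eq_imp_collinear unfolding admissible_vectors_def by metis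

text \<open>Multiplying by a monomial of degree above \<open>k / 2\<close> moves all coefficients
  past the middle index, the only obstruction to lifting. The bound on \<open>k\<close> leaves room
  for this shift.\<close>

lemma dim_quasi_invariants_large:
  assumes adm: "admissible_vectors n \<beta>" and m: "m \<ge> 1" and k: "k \<ge> 2 * (2 * m + n)"
  shows "poly2.dim (quasi_invariants (config m n \<beta>) \<inter> homogeneous k) + (m + n) = k + 1"
proof -
  let ?\<zeta> = "\<lambda>i. line_root (\<beta> i)"
  define e where "e = k div 2 + 1"
  define w where "w = (\<lambda>t. monom 1 e * partial_poly m n ?\<zeta> t)"
  have nz: "?\<zeta> i \<noteq> 0" if "i \<le> n" for i
    using adm that line_root_nonzero by (simp add: admissible_vectors_def)
  show ?thesis
  proof (rule dim_quasi_invariants_triangular[OF adm, of m w])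
    fix t assume t: "t < m + n"
    have "degree (w t) \<le> e + degree (partial_poly m n ?\<zeta> t)"
      unfolding w_def by (rule order_trans[OF degree_mult_le]) (simp add: degree_monom_eq)
    also have "\<dots> \<le> k"
      using degree_partial_poly[OF m t, of ?\<zeta>] k unfolding e_def by presburger
    finally show "degree (w t) \<le> k" .
    show "coeff (w t) a = 0" if "2 * a = k" for a
      using that by (auto simp: w_def e_def coeff_monom_mult)
    show "[:- ?\<zeta> j, 1:] ^ (2 * multip m j - 1) dvd w t" if "j \<le> n" "j \<noteq> cond_vec m t" for j
      unfolding w_def by (intro dvd_mult partial_poly_dvd_other that)
    show "[:- ?\<zeta> (cond_vec m t), 1:] ^ (2 * cond_ord m t) dvd w t"
      unfolding w_def partial_poly_def by (intro dvd_mult dvd_triv_left)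
    show "\<not> [:- ?\<zeta> (cond_vec m t), 1:] ^ (2 * cond_ord m t + 1) dvd w t"
      unfolding w_def
      by (rule partial_poly_not_dvd)
        (use admissible_line_root_inj[OF adm] nz cond_vec_le[OF t] in auto)
  qed
qed

text \<open>If the coefficient were non-zero, a shifted multiple of \<open>full_poly\<close> could
  cancel the middle coefficient of each \<open>partial_poly\<close>. The conditions would then be
  independent and the dimension equal to \<open>m + n - 1\<close>.\<close>

lemma middle_coefficient_eq_0:
  assumes adm: "admissible_vectors n \<beta>" and m: "m \<ge> 1"
    and dim: "poly2.dim (quasi_invariants (config m n \<beta>) \<inter> homogeneous (2 * (m + n) - 2)) \<noteq> m + n - 1"
    and l: "m \<le> l" "l < m + n"
  shows "coeff (full_poly m n (\<lambda>i. line_root (\<beta> i))) l = 0"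
proof (rule ccontr)
  let ?\<zeta> = "\<lambda>i. line_root (\<beta> i)"
  let ?A = "full_poly m n ?\<zeta>"
  assume A: "coeff ?A l \<noteq> 0"
  \<comment> \<open>The shift by \<open>e\<close> moves coefficient \<open>l\<close> to the middle
    index \<open>m + n - 1\<close>, and \<open>m \<le> l\<close> keeps the degree within
    \<open>2 * (m + n) - 2\<close>. The factor \<open>monom 1 0\<close> is 1 and matches the form of
    \<open>partial_poly_not_dvd\<close>.\<close>
  define e where "e = m + n - 1 - l"
  define w where "w = (\<lambda>t. monom 1 0 * partial_poly m n ?\<zeta> t
      - smult (coeff (partial_poly m n ?\<zeta> t) (m + n - 1) / coeff ?A l) (monom 1 e * ?A))"
  have nz: "?\<zeta> i \<noteq> 0" if "i \<le> n" for i
    using adm that line_root_nonzero by (simp add: admissible_vectors_def)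
  have "poly2.dim (quasi_invariants (config m n \<beta>) \<inter> homogeneous (2 * (m + n) - 2)) + (m + n)
      = 2 * (m + n) - 2 + 1"
  proof (rule dim_quasi_invariants_triangular[OF adm, of m w])
    fix t assume t: "t < m + n"
    have "degree (monom 1 e * ?A) \<le> 2 * (m + n) - 2"
      using degree_mult_le[of "monom 1 e" ?A] degree_full_poly[OF m, of n ?\<zeta>] m l
        degree_monom_le[of "1::complex" e] unfolding e_def by (simp; linarith)
    moreover have "degree (partial_poly m n ?\<zeta> t) \<le> 2 * (m + n) - 2"
      using degree_partial_poly[OF m t, of ?\<zeta>] by presburger
    ultimately show "degree (w t) \<le> 2 * (m + n) - 2"
      unfolding w_def by (intro degree_diff_le order_trans[OF degree_smult_le]) auto
    show "coeff (w t) a = 0" if "2 * a = 2 * (m + n) - 2" for a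
    proof -
      have "a = m + n - 1" using that by simp
      then show ?thesis using l A by (simp add: w_def coeff_monom_mult e_def)
    qed
    show "[:- ?\<zeta> j, 1:] ^ (2 * multip m j - 1) dvd w t" if "j \<le> n" "j \<noteq> cond_vec m t" for j
      unfolding w_def by (intro dvd_diff dvd_smult dvd_mult partial_poly_dvd_other full_poly_dvd that)
    \<comment> \<open>The subtracted multiple of \<open>full_poly\<close> is divisible by a higher
      power than \<open>partial_poly\<close>, so the exact root order is kept.\<close>
    have A_dvd: "[:- ?\<zeta> (cond_vec m t), 1:] ^ q dvd ?A" if "q \<le> 2 * cond_ord m t + 1" for q
      using full_poly_dvd[OF cond_vec_le[OF t], of ?\<zeta> m] cond_ord_less[OF t] that
      by (meson dvd_trans le_imp_power_dvd order_trans)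
    show "[:- ?\<zeta> (cond_vec m t), 1:] ^ (2 * cond_ord m t) dvd w t"
      unfolding w_def
      by (intro dvd_diff dvd_smult dvd_mult A_dvd) (auto simp: partial_poly_def intro!: dvd_mult2)
    show "\<not> [:- ?\<zeta> (cond_vec m t), 1:] ^ (2 * cond_ord m t + 1) dvd w t"
    proof
      assume "[:- ?\<zeta> (cond_vec m t), 1:] ^ (2 * cond_ord m t + 1) dvd w t"
      moreover have "[:- ?\<zeta> (cond_vec m t), 1:] ^ (2 * cond_ord m t + 1) dvd
          smult (coeff (partial_poly m n ?\<zeta> t) (m + n - 1) / coeff ?A l) (monom 1 e * ?A)"
        by (intro dvd_smult dvd_mult A_dvd order_refl)
      ultimately have "[:- ?\<zeta> (cond_vec m t), 1:] ^ (2 * cond_ord m t + 1) dvd monom 1 0 * partial_poly m n ?\<zeta> t"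
        unfolding w_def by (metis dvd_add diff_add_cancel)
      then show False
        by (rule notE[OF partial_poly_not_dvd, rotated -1])
          (use admissible_line_root_inj[OF adm] nz cond_vec_le[OF t] in auto)
    qed
  qed
  then show False using dim m by simp
qed

section \<open>Symmetry of the Hilbert series\<close>

lemma subst_poly_0 [simp]: "subst_poly 0 r = 0"
  by (simp add: subst_poly_def)

lemma subst_poly_pCons: "subst_poly (pCons a p) r = to_fract [:a:] + r * subst_poly p r"
  by (cases "a = 0 \<and> p = 0") (auto simp: subst_poly_def map_poly_pCons)

lemma to_fract_const_mult: "to_fract [:a * b:] = to_fract [:a:] * to_fract [:b :: complex:]"
  by (simp flip: to_fract_mult)

lemma to_fract_const_add: "to_fract [:a + b:] = to_fract [:a:] + to_fract [:b :: complex:]"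
  by (simp flip: to_fract_add)

lemma subst_poly_add: "subst_poly (p + q) r = subst_poly p r + subst_poly q r"
  by (induction p q rule: poly_induct2) (simp_all add: subst_poly_pCons to_fract_const_add algebra_simps)

lemma subst_poly_smult: "subst_poly (smult c p) r = to_fract [:c:] * subst_poly p r"
  by (induction p) (simp_all add: subst_poly_pCons to_fract_const_mult algebra_simps)

lemma subst_poly_mult: "subst_poly (p * q) r = subst_poly p r * subst_poly q r"
  by (induction p) (simp_all add: subst_poly_pCons subst_poly_add subst_poly_smult algebra_simps)

lemma to_fract_pCons: "to_fract (pCons a p) = to_fract [:a:] + ratvar * to_fract p"
  by (simp add: ratvar_def flip: to_fract_add to_fract_mult)

lemma to_fract_monom: "to_fract (monom a e) = to_fract [:a:] * ratvar ^ e"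
  by (induction e) (simp_all add: monom_0 monom_Suc to_fract_pCons[of 0])

lemma subst_poly_ratvar: "subst_poly p ratvar = to_fract p"
proof (induction p)
  case (pCons a p)
  show ?case unfolding subst_poly_pCons pCons.IH by (rule to_fract_pCons[symmetric])
qed simp

lemma ratvar_nonzero: "ratvar \<noteq> 0"
  by (simp add: ratvar_def)

lemma subst_poly_inverse_ratvar:
  "to_fract (reflect_poly p) = ratvar ^ degree p * subst_poly p (inverse ratvar)"
proof (induction p)
  case (pCons a p)
  show ?case
  proof (cases "p = 0")
    case False
    have "reflect_poly (pCons a p) = reflect_poly p + monom a (Suc (degree p))"
      using reflect_poly_pCons'[OF False] by simp
    then have "to_fract (reflect_poly (pCons a p)) =
        ratvar ^ degree p * subst_poly p (inverse ratvar) + to_fract [:a:] * ratvar ^ Suc (degree p)"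
      by (simp only: to_fract_add to_fract_monom pCons.IH)
    also have "\<dots> = ratvar ^ Suc (degree p) * (to_fract [:a:] + inverse ratvar * subst_poly p (inverse ratvar))"
      using ratvar_nonzero by (simp add: distrib_left)
    finally show ?thesis
      using False by (simp add: subst_poly_pCons)
  qed (simp add: subst_poly_pCons)
qed simp

text \<open>The equation says that the reversed polynomial is a power of the variable times
  \<open>U\<close>. Both have non-zero constant coefficient, so this power is trivial.\<close>

lemma reflect_poly_eq_if_subst_eq:
  assumes U0: "coeff U 0 \<noteq> 0" and eq: "subst_poly U (inverse ratvar) = ratvar powi M * to_fract U"
  shows "reflect_poly U = U"
proof -
  define e where "e = int (degree U) + M"
  have U: "U \<noteq> 0" using U0 by auto
  have pw: "ratvar ^ a = to_fract (monom 1 a)" for a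
    by (simp add: to_fract_monom pCons_one)
  have refl: "to_fract (reflect_poly U) = ratvar powi e * to_fract U"
    using ratvar_nonzero by (simp add: subst_poly_inverse_ratvar eq e_def power_int_add)
  show ?thesis
  proof (cases "e \<ge> 0")
    case True
    then obtain a where a: "e = int a" using nonneg_int_cases by blast
    have "to_fract (reflect_poly U) = to_fract (monom 1 a * U)"
      unfolding refl a power_int_of_nat pw to_fract_mult ..
    then have r: "reflect_poly U = monom 1 a * U" by (simp only: to_fract_eq_iff)
    then have "coeff (monom 1 a * U) 0 \<noteq> 0" using U by (metis coeff_0_reflect_poly_0_iff)
    then have "a = 0" by (auto simp: coeff_monom_mult split: if_splits)
    then show ?thesis using r by simp
  next
    case False
    then obtain a where a: "e = - int a" "a > 0" using neg_int_cases by (metis not_le)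
    have "to_fract U = ratvar ^ a * to_fract (reflect_poly U)"
      unfolding refl a power_int_minus power_int_of_nat using ratvar_nonzero by simp
    then have "to_fract U = to_fract (monom 1 a * reflect_poly U)"
      by (simp only: pw to_fract_mult)
    then have "U = monom 1 a * reflect_poly U" by (simp only: to_fract_eq_iff)
    then have "coeff U 0 = coeff (monom 1 a * reflect_poly U) 0" by simp
    also have "\<dots> = 0" using a(2) by (simp add: coeff_monom_mult)
    finally show ?thesis using U0 by simp
  qed
qed

text \<open>Pairing the index \<open>i\<close> with \<open>degree U - i\<close> shows that twice the
  sum of the \<open>i * coeff U i\<close> is \<open>degree U\<close> times the sum of the
  coefficients.\<close>

lemma palindromic_degree:
  fixes U :: "complex poly"
  assumes "reflect_poly U = U"
  shows "of_nat (degree U) * poly U 1 = 2 * poly (pderiv U) 1"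
proof -
  let ?d = "degree U"
  have sym: "coeff U (?d - i) = coeff U i" if "i \<le> ?d" for i
    using that coeff_reflect_poly[of U i] by (simp add: assms)
  have "poly (pderiv U) 1 = (\<Sum>i\<le>?d. of_nat i * coeff U i)"
  proof -
    have "poly (pderiv U) 1 = (\<Sum>i\<le>?d. of_nat (Suc i) * coeff U (Suc i))"
      using poly_altdef_le[of "pderiv U" ?d 1] by (simp add: degree_pderiv coeff_pderiv del: of_nat_Suc)
    also have "\<dots> = (\<Sum>i\<le>Suc ?d. of_nat i * coeff U i)"
      by (subst sum.atMost_Suc_shift) simp
    also have "\<dots> = (\<Sum>i\<le>?d. of_nat i * coeff U i)"
      by (simp add: coeff_eq_0)
    finally show ?thesis .
  qed
  moreover have "(\<Sum>i\<le>?d. of_nat i * coeff U i) = (\<Sum>i\<le>?d. of_nat (?d - i) * coeff U i)"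
    by (rule sum.reindex_bij_witness[of _ "\<lambda>i. ?d - i" "\<lambda>i. ?d - i"]) (auto simp: sym)
  moreover have "(\<Sum>i\<le>?d. of_nat i * coeff U i) + (\<Sum>i\<le>?d. of_nat (?d - i) * coeff U i)
      = (\<Sum>i\<le>?d. of_nat ?d * coeff U i)"
    unfolding sum.distrib[symmetric] by (intro sum.cong refl) (auto simp: of_nat_diff algebra_simps)
  ultimately show ?thesis
    by (simp add: poly_altdef sum_distrib_left)
qed

text \<open>The polynomial \<open>e\<close> is the difference between \<open>F\<close> and the
  expansion of \<open>1 / (1 - t)\<^sup>2 - c / (1 - t)\<close>.\<close>

lemma fps_times_square_eq_poly:
  fixes F :: "complex fps"
  assumes F: "\<And>k. k \<ge> K \<Longrightarrow> fps_nth F k = of_nat (k + 1) - c"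
  defines "e \<equiv> \<Sum>k<K. monom (fps_nth F k - of_nat (k + 1) + c) k"
  shows "F * fps_of_poly ([:1, - 1:]\<^sup>2) = fps_of_poly ([:1 - c, c:] + e * [:1, - 1:]\<^sup>2)"
proof -
  define G where "G = Abs_fps (\<lambda>k. of_nat (k + 1) :: complex)"
  define G1 where "G1 = Abs_fps (\<lambda>k. 1 :: complex)"
  have coeff_e: "coeff e k = fps_nth F k - of_nat (k + 1) + c" for k
    using F[of k] by (simp add: e_def coeff_sum)
  have F_eq: "F = G - fps_const c * G1 + fps_of_poly e"
    by (rule fps_ext) (simp add: G_def G1_def coeff_e)
  have L: "fps_of_poly [:1, - 1:] = 1 - (fps_X :: complex fps)"
    by (simp add: fps_of_poly_pCons)
  have 1: "G1 * (1 - fps_X) = 1"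
    by (rule fps_ext) (auto simp: G1_def right_diff_distrib fps_X_mult_right_nth)
  have 2: "G * (1 - fps_X) = G1"
    by (rule fps_ext) (auto simp: G1_def G_def right_diff_distrib fps_X_mult_right_nth of_nat_diff)
  have "F * (1 - fps_X)\<^sup>2 = (G * (1 - fps_X)) * (1 - fps_X) - fps_const c * (G1 * (1 - fps_X)) * (1 - fps_X)
      + fps_of_poly e * (1 - fps_X)\<^sup>2"
    unfolding F_eq power2_eq_square by (simp add: algebra_simps)
  also have "\<dots> = 1 - fps_const c * (1 - fps_X) + fps_of_poly e * (1 - fps_X)\<^sup>2"
    by (simp only: 1 2 mult_1_right)
  also have "1 - fps_const c * (1 - fps_X) = fps_of_poly [:1 - c, c:]"
    by (simp add: fps_of_poly_pCons algebra_simps flip: fps_const_sub)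
  finally show ?thesis
    by (simp add: fps_of_poly_add fps_of_poly_mult fps_of_poly_power L)
qed

text \<open>The polynomial \<open>e\<close> measures the deviation from the eventual coefficient
  formula. The symmetry fixes the degree of the numerator \<open>U\<close>, hence that of
  \<open>e\<close> as \<open>2 * N - 2\<close>, and the leading coefficient of \<open>e\<close> is
  the asserted deviation.\<close>

lemma gorenstein_coefficient:
  fixes F :: "complex fps"
  assumes F: "\<And>k. k \<ge> K \<Longrightarrow> fps_nth F k = of_nat (k + 1) - of_nat N"
    and F0: "fps_nth F 0 \<noteq> 0" and N: "N \<ge> 2"
    and D: "D \<noteq> 0" and num: "F * fps_of_poly D = fps_of_poly P"
    and sym: "subst_poly P (inverse ratvar) / subst_poly D (inverse ratvar) =
      ratvar powi M * (subst_poly P ratvar / subst_poly D ratvar)"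
  shows "fps_nth F (2 * N - 2) \<noteq> of_nat N - 1"
proof -
  define e where "e = (\<Sum>k<K. monom (fps_nth F k - of_nat (k + 1) + of_nat N) k)"
  define W :: "complex poly" where "W = [:1, - 1:]\<^sup>2"
  define U where "U = [:1 - of_nat N, of_nat N:] + e * W"
  have FU: "F * fps_of_poly W = fps_of_poly U"
    using fps_times_square_eq_poly[OF F] unfolding W_def U_def e_def by simp
  \<comment> \<open>\<open>P / D\<close> and \<open>U / W\<close> expand to the same series, so the
    symmetry passes to \<open>U / W\<close>.\<close>
  have "fps_of_poly (P * W) = fps_of_poly (U * D)"
    unfolding fps_of_poly_mult num[symmetric] FU[symmetric] by (simp add: mult_ac)
  then have PW: "P * W = U * D" by (simp only: fps_of_poly_eq_iff)
  have W0: "W \<noteq> 0" by (simp add: W_def)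
  have subst_nz: "subst_poly Q (inverse ratvar) \<noteq> 0" if "Q \<noteq> 0" for Q
    using subst_poly_inverse_ratvar[of Q] that by auto
  have quot: "subst_poly P r / subst_poly D r = subst_poly U r / subst_poly W r"
    if "subst_poly D r \<noteq> 0" "subst_poly W r \<noteq> 0" for r
    using arg_cong[OF PW, of "\<lambda>p. subst_poly p r"] that by (simp add: subst_poly_mult frac_eq_eq)
  have 1: "subst_poly U (inverse ratvar) / subst_poly W (inverse ratvar) = ratvar powi M * (to_fract U / to_fract W)"
    using sym D W0
    unfolding quot[OF subst_nz[OF D] subst_nz[OF W0]] by (subst (asm) quot) (auto simp: subst_poly_ratvar)
  \<comment> \<open>\<open>W\<close> has degree 2 and is its own reversal, which turns the exponent
    \<open>M\<close> into \<open>M - 2\<close> for \<open>U\<close>.\<close>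
  have 2: "to_fract W = subst_poly W (inverse ratvar) * ratvar powi 2"
  proof -
    have "reflect_poly W = W" "degree W = 2"
      by (simp_all add: W_def power2_eq_square reflect_poly_mult reflect_poly_pCons)
    then show ?thesis using subst_poly_inverse_ratvar[of W] by (simp add: mult.commute)
  qed
  have "subst_poly U (inverse ratvar)
      = subst_poly W (inverse ratvar) * (subst_poly U (inverse ratvar) / subst_poly W (inverse ratvar))"
    using subst_nz[OF W0] by simp
  also have "\<dots> = ratvar powi (M - 2) * to_fract U"
    unfolding 1 2 using subst_nz[OF W0] ratvar_nonzero by (simp add: power_int_diff)
  finally have "subst_poly U (inverse ratvar) = ratvar powi (M - 2) * to_fract U" .
  moreover have "coeff U 0 \<noteq> 0"
  proof -
    have "coeff U 0 = fps_nth (F * fps_of_poly W) 0" by (simp add: FU)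
    then show ?thesis using F0 by (simp add: W_def coeff_0_power flip: poly_0_coeff_0)
  qed
  ultimately have pal: "reflect_poly U = U" by (rule reflect_poly_eq_if_subst_eq[rotated])
  \<comment> \<open>Because of the double root of \<open>W\<close> at 1, only the linear part of
    \<open>U\<close> contributes to its value and derivative there.\<close>
  have "poly W 1 = 0" "poly (pderiv W) 1 = 0"
    by (simp_all add: W_def power2_eq_square pderiv_pCons)
  then have "poly U 1 = 1" "poly (pderiv U) 1 = of_nat N"
    by (simp_all add: U_def pderiv_add pderiv_mult pderiv_pCons)
  then have "of_nat (degree U) = (of_nat (2 * N) :: complex)"
    using palindromic_degree[OF pal] by simp
  then have deg: "degree U = 2 * N" by (simp only: of_nat_eq_iff)
  have eW: "degree (e * W) = 2 * N"
  proof -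
    have "degree [:1 - of_nat N, of_nat N :: complex:] < degree U"
      using N deg by (auto intro: le_less_trans[OF degree_pCons_le])
    moreover have "e * W = U - [:1 - of_nat N, of_nat N:]" by (simp add: U_def)
    ultimately show ?thesis
      using deg by (metis degree_add_eq_left degree_minus diff_conv_add_uminus)
  qed
  then have "e \<noteq> 0" using N by auto
  then have "degree e = 2 * N - 2"
    using eW W0 by (simp add: degree_mult_eq W_def degree_power_eq)
  then have "coeff e (2 * N - 2) \<noteq> 0"
    using \<open>e \<noteq> 0\<close> by (metis leading_coeff_neq_0)
  moreover have "coeff e (2 * N - 2) = fps_nth F (2 * N - 2) - of_nat (2 * N - 2 + 1) + of_nat N"
    using F[of "2 * N - 2"] by (simp add: e_def coeff_sum)
  ultimately show ?thesis using N by (auto simp: of_nat_diff)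
qed

section \<open>Polynomials with a gap and a multiple root\<close>

text \<open>
  Each operator \<open>x d/dx - e\<close> kills one monomial and lowers the order of vanishing at 1 by at most
  one.
\<close>

lemma lacunary_poly_eq_0:
  fixes R :: "complex poly"
  assumes "finite S" "\<And>l. l \<notin> S \<Longrightarrow> coeff R l = 0" "[:- 1, 1:] ^ card S dvd R"
  shows "R = 0"
  using assms
proof (induction S arbitrary: R rule: finite_induct)
  case empty
  then show ?case by (auto intro: poly_eqI)
next
  case (insert e S)
  define R' where "R' = pCons 0 (pderiv R) - smult (of_nat e) R"
  have coeff: "coeff R' l = (of_nat l - of_nat e) * coeff R l" for l
    by (cases l) (simp_all add: R'_def coeff_pderiv algebra_simps)
  have "[:- 1, 1:] ^ Suc (card S) dvd R"
    using insert.prems(2) insert.hyps by (simp del: power_Suc)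
  then obtain h where R: "R = [:- 1, 1:] ^ Suc (card S) * h" by (rule dvdE)
  have "pderiv R = [:- 1, 1:] ^ card S * ([:- 1, 1:] * pderiv h + smult (of_nat (Suc (card S))) h)"
    unfolding R pderiv_mult pderiv_power_Suc by (simp add: pderiv_pCons algebra_simps)
  then have "[:- 1, 1:] ^ card S dvd pderiv R" by (rule dvdI)
  then have "[:- 1, 1:] ^ card S dvd [:0, 1:] * pderiv R" by (rule dvd_mult)
  moreover have "[:- 1, 1:] ^ card S dvd R" unfolding R power_Suc2 mult.assoc by (rule dvd_triv_left)
  ultimately have "[:- 1, 1:] ^ card S dvd R'"
    unfolding R'_def by (intro dvd_diff dvd_smult) auto
  then have "R' = 0"
    using insert by (intro insert.IH) (auto simp: coeff)
  then have "coeff R l = 0" if "l \<noteq> e" for l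
    using coeff[of l] that by simp
  then have "R = monom (coeff R e) e" by (intro poly_eqI) auto
  moreover have "poly R 1 = 0" by (simp add: R)
  ultimately have "coeff R e = 0" by (metis poly_monom power_one mult_1_right)
  then show ?case using \<open>R = monom (coeff R e) e\<close> by simp
qed

definition hyp_op :: "complex \<Rightarrow> complex \<Rightarrow> complex \<Rightarrow> complex poly \<Rightarrow> complex poly" where
  "hyp_op a b c p = [:0, 1, - 1:] * pderiv (pderiv p) + [:c, - (a + b + 1):] * pderiv p - smult (a * b) p"

lemma coeff_hyp_op:
  "coeff (hyp_op a b c p) l =
    of_nat (l + 1) * (of_nat l + c) * coeff p (l + 1) - (of_nat l + a) * (of_nat l + b) * coeff p l"
proof (cases l)
  case 0
  then show ?thesis by (simp add: hyp_op_def coeff_pderiv algebra_simps)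
next
  case (Suc l')
  then show ?thesis
    by (cases l') (simp_all add: hyp_op_def coeff_pderiv algebra_simps)
qed

text \<open>Euler's transformation of the hypergeometric equation.\<close>

lemma hyp_op_euler:
  assumes "a + b = c + of_nat p"
  shows "hyp_op (c - a) (c - b) c ([:- 1, 1:] ^ p * E) = [:- 1, 1:] ^ p * hyp_op a b c E"
proof -
  define P where "P = ([:- 1, 1:] :: complex poly) ^ p"
  define L where "L = ([:- 1, 1:] :: complex poly)"
  have hyp_op_ring: "hyp_op u v w q = - (L + 1) * L * pderiv (pderiv q)
      + ([:w:] - ([:u:] + [:v:] + 1) * (L + 1)) * pderiv q - [:u:] * [:v:] * q" for u v w q
  proof -
    have "[:0, 1, - 1:] = - (L + 1) * L"
      "[:w, - (u + v + 1):] = [:w:] - ([:u:] + [:v:] + 1) * (L + 1)"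
      by (simp_all add: L_def one_pCons)
    then show ?thesis by (simp add: hyp_op_def mult.commute)
  qed
  have "L * pderiv P = smult (of_nat p) P"
  proof (cases p)
    case (Suc p')
    have "pderiv L = 1" by (simp add: L_def pderiv_pCons)
    then show ?thesis
      unfolding P_def L_def[symmetric] Suc pderiv_power_Suc by simp
  qed (simp add: P_def)
  then have 1: "L * pderiv P = ([:a:] + [:b:] - [:c:]) * P"
    using assms by simp
  have "pderiv (L * pderiv P) = L * pderiv (pderiv P) + pderiv P"
    by (simp add: pderiv_mult L_def pderiv_pCons del: mult_pCons_left)
  then have 2: "L * pderiv (pderiv P) = ([:a:] + [:b:] - [:c:] - 1) * pderiv P"
    unfolding 1 pderiv_mult by (simp add: pderiv_add pderiv_diff algebra_simps)
  have c: "[:c - a:] = [:c:] - [:a:]" "[:c - b:] = [:c:] - [:b:]" by simp_all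
  have "pderiv (P * E) = P * pderiv E + E * pderiv P" by (rule pderiv_mult)
  moreover have "pderiv (pderiv (P * E)) = P * pderiv (pderiv E) + 2 * pderiv P * pderiv E + E * pderiv (pderiv P)"
    by (simp add: pderiv_mult pderiv_add algebra_simps)
  ultimately show ?thesis
    unfolding P_def[symmetric] hyp_op_ring c using 1 2 by algebra
qed

lemma gap_poly_coeff_recursion:
  fixes E :: "complex poly"
  assumes m: "m \<ge> 1" and deg: "degree E \<le> n"
    and gap: "\<And>l. m \<le> l \<Longrightarrow> l < m + n \<Longrightarrow> coeff ([:- 1, 1:] ^ (2 * m - 1) * E) l = 0"
    and k: "k < n"
  shows "of_nat ((k + 1) * (m + n - 1 - k)) * coeff E (n - (k + 1)) = of_nat ((n - k) * (m + k)) * coeff E (n - k)"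
proof -
  define A where "A = [:- 1, 1:] ^ (2 * m - 1) * E"
  define c where "c = (1 - of_nat m - of_nat n :: complex)"
  define S where "S = {..<m - 1} \<union> {m + n..<2 * m + n - 1}"
  define R where "R = hyp_op (c + of_nat n) (c - of_nat m) c A"
  have euler: "R = [:- 1, 1:] ^ (2 * m - 1) * hyp_op (- of_nat n) (of_nat m) c E"
    using m hyp_op_euler[of "- of_nat n" "of_nat m" c "2 * m - 1" E]
    by (simp add: R_def A_def c_def of_nat_diff)
  have A_gap: "coeff A l = 0" if "m \<le> l" "l < m + n" for l
    using gap that by (simp add: A_def)
  have "degree A \<le> 2 * m - 1 + n"
    unfolding A_def using degree_mult_le[of "[:- 1, 1:] ^ (2 * m - 1)" E] deg
    by (simp add: degree_linear_power)
  then have A_deg: "coeff A l = 0" if "l \<ge> 2 * m + n" for l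
    using that m by (intro coeff_eq_0) simp
  have "coeff R l = 0" if l: "l \<notin> S" for l
  proof -
    have l: "l + 1 \<ge> m" "l \<le> m + n - 1 \<or> l + 1 \<ge> 2 * m + n"
      using l m by (auto simp: S_def)
    have "(of_nat l + c) * coeff A (l + 1) = 0"
    proof (cases "l = m + n - 1")
      case True
      then show ?thesis using m by (simp add: c_def of_nat_diff)
    next
      case False
      then show ?thesis using l k A_gap[of "l + 1"] A_deg[of "l + 1"] by fastforce
    qed
    moreover have "(of_nat l + (c + of_nat n)) * (of_nat l + (c - of_nat m)) * coeff A l = 0"
    proof -
      consider "l + 1 = m" | "l + 1 = 2 * m + n" | "coeff A l = 0"
        using l k A_gap[of l] A_deg[of l] by fastforce
      then show ?thesis
      proof cases
        case 1
        then have "of_nat l = (of_nat m - 1 :: complex)" using m by (auto simp: of_nat_diff)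
        then show ?thesis by (simp add: c_def)
      next
        case 2
        then have "of_nat l = (2 * of_nat m + of_nat n - 1 :: complex)"
          by (metis add_diff_cancel_right' of_nat_1 of_nat_add of_nat_mult of_nat_numeral)
        then show ?thesis by (simp add: c_def)
      qed simp
    qed
    ultimately show ?thesis by (simp only: R_def coeff_hyp_op mult.assoc)  simp
  qed
  moreover have "[:- 1, 1:] ^ card S dvd R"
  proof -
    have "card S = (m - 1) + (2 * m + n - 1 - (m + n))"
      unfolding S_def by (subst card_Un_disjoint) auto
    then have "card S \<le> 2 * m - 1" by simp
    then show ?thesis unfolding euler by (intro dvd_mult2 le_imp_power_dvd)
  qed
  ultimately have "R = 0" by (intro lacunary_poly_eq_0[of S]) (auto simp: S_def)
  then have "hyp_op (- of_nat n) (of_nat m) c E = 0"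
    unfolding euler by (subst (asm) mult_eq_0_iff) simp
  then have "coeff (hyp_op (- of_nat n) (of_nat m) c E) (n - (k + 1)) = 0" by simp
  moreover have "n - (k + 1) + 1 = n - k" using k by simp
  ultimately have rec: "of_nat (n - k) * (of_nat (n - (k + 1)) + c) * coeff E (n - k)
      - (of_nat (n - (k + 1)) + - of_nat n) * (of_nat (n - (k + 1)) + of_nat m) * coeff E (n - (k + 1)) = 0"
    by (simp only: coeff_hyp_op)
  have nat: "of_nat (n - (k + 1)) = (of_nat n - of_nat k - 1 :: complex)"
    "of_nat (n - k) = (of_nat n - of_nat k :: complex)"
    "of_nat (m + n - 1 - k) = (of_nat m + of_nat n - 1 - of_nat k :: complex)"
    using k m by (simp_all add: of_nat_diff)
  show ?thesis
    using rec unfolding of_nat_mult of_nat_add of_nat_1 nat c_def by algebra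
qed

lemma coeff_gap_poly:
  fixes E :: "complex poly"
  assumes m: "m \<ge> 1" and deg: "degree E \<le> n" and lead: "coeff E n = 1"
    and gap: "\<And>l. m \<le> l \<Longrightarrow> l < m + n \<Longrightarrow> coeff ([:- 1, 1:] ^ (2 * m - 1) * E) l = 0"
    and k: "k \<le> n"
  shows "coeff E (n - k) = of_nat (n choose k) * of_nat ((m + k - 1) choose k) / of_nat ((m + n - 1) choose k)"
  using k
proof (induction k)
  case 0
  then show ?case using lead by simp
next
  case (Suc k)
  define x where "x = (of_nat (n choose k) :: complex)"
  define x' where "x' = (of_nat (n choose Suc k) :: complex)"
  define y where "y = (of_nat ((m + k - 1) choose k) :: complex)"
  define y' where "y' = (of_nat ((m + Suc k - 1) choose Suc k) :: complex)"
  define z where "z = (of_nat ((m + n - 1) choose k) :: complex)"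
  define z' where "z' = (of_nat ((m + n - 1) choose Suc k) :: complex)"
  define K where "K = (of_nat (Suc k) :: complex)"
  have "Suc k * (n choose Suc k) = (n - k) * (n choose k)"
    by (metis binomial_absorb_comp binomial_absorption mult.commute)
  then have x: "K * x' = of_nat (n - k) * x"
    unfolding K_def x_def x'_def by (metis of_nat_mult)
  have "Suc k * ((m + n - 1) choose Suc k) = (m + n - 1 - k) * ((m + n - 1) choose k)"
    by (metis binomial_absorb_comp binomial_absorption mult.commute)
  then have z: "K * z' = of_nat (m + n - 1 - k) * z"
    unfolding K_def z_def z'_def by (metis of_nat_mult)
  have "Suc k * ((m + k) choose Suc k) = (m + k) * ((m + k - 1) choose k)"
    using binomial_absorption[of k "m + k"] by simp
  then have y: "K * y' = of_nat (m + k) * y"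
    unfolding K_def y_def y'_def by (metis add_Suc_right diff_Suc_1 of_nat_mult)
  have "m + n - 1 - k \<noteq> 0" using Suc.prems m by simp
  then have nz0: "of_nat (m + n - 1 - k) \<noteq> (0 :: complex)" by (simp only: of_nat_eq_0_iff not_False_eq_True)
  have nz: "K \<noteq> 0" "z \<noteq> 0" "z' \<noteq> 0"
    using Suc.prems m by (auto simp: K_def z_def z'_def simp del: of_nat_Suc)
  have IH: "coeff E (n - k) = x * y / z"
    using Suc by (simp add: x_def y_def z_def)
  have "K * of_nat (m + n - 1 - k) * coeff E (n - Suc k) = of_nat (n - k) * of_nat (m + k) * (x * y / z)"
    unfolding IH[symmetric] K_def Suc_eq_plus1 of_nat_mult[symmetric]
    using gap_poly_coeff_recursion[OF m deg gap, of k] Suc.prems by simp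
  also have "\<dots> = (K * x') * (K * y') / z" unfolding x y by simp
  also have "\<dots> = K * of_nat (m + n - 1 - k) * (x' * y' / z')"
  proof -
    have "K / z = of_nat (m + n - 1 - k) / z'"
      using nz z by (simp add: frac_eq_eq mult.commute)
    moreover have "(K * x') * (K * y') / z = K * x' * y' * (K / z)" by simp
    ultimately show ?thesis by (simp only:) simp
  qed
  finally have "coeff E (n - Suc k) = x' * y' / z'"
    using nz(1) nz0 by (simp only: mult_cancel_left mult_eq_0_iff simp_thms)
  then show ?case by (simp add: x'_def y'_def z'_def)
qed

lemma elem_sym_eq_coeff:
  assumes "k \<le> n"
  shows "elem_sym n k y = (-1) ^ k * coeff (\<Prod>i=1..n. [:- y i, 1:]) (n - k)"
proof -
  have "(\<Prod>i=1..n. [:- y i, 1:]) = (\<Prod>i=1..n. [:- y i:] + monom 1 1)"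
    by (simp add: monom_Suc monom_0)
  also have "\<dots> = (\<Sum>X\<in>Pow {1..n}. (\<Prod>i\<in>X. [:- y i:]) * (\<Prod>i\<in>{1..n} - X. monom 1 1))"
    by (rule prod_add) simp
  also have "\<dots> = (\<Sum>X\<in>Pow {1..n}. monom ((- 1) ^ card X * (\<Prod>i\<in>X. y i)) (n - card X))"
  proof (intro sum.cong refl)
    fix X assume X: "X \<in> Pow {1..n}"
    then have "finite X" "card ({1..n} - X) = n - card X"
      by (auto simp: card_Diff_subset finite_subset)
    moreover have "(\<Prod>i\<in>X. [:- y i:]) = [:(- 1) ^ card X * (\<Prod>i\<in>X. y i):]"
      using \<open>finite X\<close> by (induction X rule: finite_induct) (auto simp: one_pCons)
    ultimately show "(\<Prod>i\<in>X. [:- y i:]) * (\<Prod>i\<in>{1..n} - X. monom 1 1)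
        = monom ((- 1) ^ card X * (\<Prod>i\<in>X. y i)) (n - card X)"
      by (simp add: monom_power smult_monom)
  qed
  finally have "coeff (\<Prod>i=1..n. [:- y i, 1:]) (n - k)
      = (\<Sum>X\<in>Pow {1..n}. if n - card X = n - k then (- 1) ^ card X * (\<Prod>i\<in>X. y i) else 0)"
    by (simp add: coeff_sum)
  also have "\<dots> = (\<Sum>X\<in>Pow {1..n}. if card X = k then (- 1) ^ k * (\<Prod>i\<in>X. y i) else 0)"
  proof (intro sum.cong refl)
    fix X assume "X \<in> Pow {1..n}"
    then have "card X \<le> n" using card_mono[of "{1..n}" X] by simp
    then have "n - card X = n - k \<longleftrightarrow> card X = k" using assms by auto
    then show "(if n - card X = n - k then (- 1) ^ card X * (\<Prod>i\<in>X. y i) else 0)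
        = (if card X = k then (- 1) ^ k * (\<Prod>i\<in>X. y i) else 0)" by simp
  qed
  also have "\<dots> = (- 1) ^ k * elem_sym n k y"
    by (simp add: elem_sym_def sum.If_cases sum_distrib_left Pow_def Collect_conj_eq)
  finally show ?thesis by (simp flip: power_add mult.assoc)
qed

section \<open>Reduction to the special configuration\<close>

lemma dim_quasi_invariants_0: "poly2.dim (quasi_invariants A \<inter> homogeneous 0) = 1"
proof -
  have "dir_deriv \<beta> 1 = 0" for \<beta>
    by (simp add: dir_deriv_def pderiv_pCons map_poly_pCons one_pCons)
  then have "(dir_deriv \<beta> ^^ (2 * s - 1)) 1 = 0" if "s \<ge> 1" for \<beta> s
  proof -
    have "(dir_deriv \<beta> ^^ r) 0 = 0" for r
      by (induction r) simp_all
    moreover have "2 * s - 1 = Suc (2 * s - 2)" using that by simp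
    ultimately show ?thesis
      using \<open>dir_deriv \<beta> 1 = 0\<close> by (simp add: funpow_swap1)
  qed
  then have "{1} \<subseteq> quasi_invariants A \<inter> homogeneous 0"
    by (auto simp: quasi_invariants_def homogeneous_def one_pCons coeff_pCons split: nat.splits)
  moreover have "quasi_invariants A \<inter> homogeneous 0 \<subseteq> poly2.span {1}"
    using homogeneous_span[of 0] by (auto simp: one_pCons monom_0)
  ultimately have "card {1 :: poly2} = poly2.dim (quasi_invariants A \<inter> homogeneous 0)"
    by (rule poly2.basis_card_eq_dim) simp
  then show ?thesis by simp
qed

lemma gorenstein_imp_middle_coefficients:
  assumes adm: "admissible_vectors n \<beta>" and m: "m \<ge> 1" and n: "n \<ge> 1"
    and gor: "gorenstein (config m n \<beta>)" and l: "m \<le> l" "l < m + n"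
  shows "coeff (full_poly m n (\<lambda>i. line_root (\<beta> i))) l = 0"
proof (rule middle_coefficient_eq_0[OF adm m _ l])
  let ?F = "hilbert_series (config m n \<beta>)"
  obtain N D M where D: "D \<noteq> 0" "?F * fps_of_poly D = fps_of_poly N"
    and sym: "subst_poly N (inverse ratvar) / subst_poly D (inverse ratvar) =
      ratvar powi M * (subst_poly N ratvar / subst_poly D ratvar)"
    using gor by (auto simp: gorenstein_def)
  have "fps_nth ?F k = of_nat (k + 1) - of_nat (m + n)" if "k \<ge> 2 * (2 * m + n)" for k
    using arg_cong[OF dim_quasi_invariants_large[OF adm m that], of "of_nat :: nat \<Rightarrow> complex"]
    by (simp add: hilbert_series_def algebra_simps)
  moreover have "fps_nth ?F 0 \<noteq> 0"
    by (simp add: hilbert_series_def dim_quasi_invariants_0)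
  ultimately have "fps_nth ?F (2 * (m + n) - 2) \<noteq> of_nat (m + n) - 1"
    using m n D sym by (intro gorenstein_coefficient) auto
  then show "poly2.dim (quasi_invariants (config m n \<beta>) \<inter> homogeneous (2 * (m + n) - 2)) \<noteq> m + n - 1"
    using m by (auto simp: hilbert_series_def of_nat_diff)
qed

lemma pcompose_power: "pcompose (p ^ r) q = pcompose p q ^ r"
  by (induction r) (simp_all add: pcompose_mult one_pCons)

lemma gap_of_scaled_roots:
  assumes m: "m \<ge> 1" and z: "\<zeta> 0 \<noteq> 0" and gap: "coeff (full_poly m n \<zeta>) l = 0"
  shows "coeff ([:- 1, 1:] ^ (2 * m - 1) * (\<Prod>i=1..n. [:- (\<zeta> i / \<zeta> 0), 1:])) l = 0"
proof -
  let ?E = "\<Prod>i=1..n. [:- (\<zeta> i / \<zeta> 0), 1:]"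
  have full: "full_poly m n \<zeta> = [:- \<zeta> 0, 1:] ^ (2 * m - 1) * (\<Prod>i=1..n. [:- \<zeta> i, 1:])"
  proof -
    have "{..n} = insert 0 {1..n}" by auto
    then show ?thesis
      unfolding full_poly_def by (simp add: multip_def) 
  qed
  have lin: "pcompose [:- w, 1:] [:0, \<zeta> 0:] = smult (\<zeta> 0) [:- (w / \<zeta> 0), 1:]" for w
    using z by (simp add: pcompose_pCons)
  have "pcompose (full_poly m n \<zeta>) [:0, \<zeta> 0:]
      = (smult (\<zeta> 0) [:- 1, 1:]) ^ (2 * m - 1) * (\<Prod>i=1..n. smult (\<zeta> 0) [:- (\<zeta> i / \<zeta> 0), 1:])"
    using lin[of "\<zeta> 0"] z by (simp only: full pcompose_mult pcompose_power pcompose_prod lin) simp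
  also have "\<dots> = smult (\<zeta> 0 ^ (2 * m - 1) * \<zeta> 0 ^ n) ([:- 1, 1:] ^ (2 * m - 1) * ?E)"
    by (simp only: smult_power prod_smult mult_smult_left mult_smult_right smult_smult)
      (simp add: mult.commute)
  finally have "coeff (smult (\<zeta> 0 ^ (2 * m - 1) * \<zeta> 0 ^ n) ([:- 1, 1:] ^ (2 * m - 1) * ?E)) l = 0"
    using gap by (metis coeff_pcompose_linear mult_zero_right)
  then show ?thesis using z by (simp only: coeff_smult) simp
qed

lemma config_eq_image: "config m n \<beta> = (\<lambda>i. (\<beta> i, multip m i)) ` {..n}"
proof -
  have "{..n} = insert 0 {1..n}" by auto
  then show ?thesis by (auto simp: config_def multip_def)
qed

lemma inj_on_config:
  assumes "admissible_vectors n \<beta>"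
  shows "inj_on (\<lambda>i. (\<beta> i, multip m i)) {..n}"
proof (rule inj_onI)
  fix i j assume "i \<in> {..n}" "j \<in> {..n}" "(\<beta> i, multip m i) = (\<beta> j, multip m j)"
  then show "i = j"
    using assms unfolding admissible_vectors_def by (metis Pair_inject atMost_iff vector_smult_lid)
qed

lemma config_equivI:
  assumes T: "orthogonal_matrix T" and \<beta>: "admissible_vectors n \<beta>" and \<gamma>: "admissible_vectors n \<gamma>"
    and c: "\<And>i. i \<le> n \<Longrightarrow> \<exists>c. \<gamma> i = c *s (T *v \<beta> i)"
  shows "config_equiv (config m n \<beta>) (config m n \<gamma>)"
proof -
  let ?f = "\<lambda>i. (\<beta> i, multip m i)" and ?g = "\<lambda>i. (\<gamma> i, multip m i)"
  define f where "f = ?g \<circ> inv_into {..n} ?f"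
  have "bij_betw ?f {..n} (config m n \<beta>)" "bij_betw ?g {..n} (config m n \<gamma>)"
    using inj_on_config[OF \<beta>] inj_on_config[OF \<gamma>] by (auto simp: config_eq_image bij_betw_def)
  then have "bij_betw f (config m n \<beta>) (config m n \<gamma>)"
    unfolding f_def by (blast intro: bij_betw_trans bij_betw_inv_into)
  moreover have "\<exists>c. c \<noteq> 0 \<and> f (u, k) = (c *s (T *v u), k)" if uk: "(u, k) \<in> config m n \<beta>" for u k
  proof -
    obtain i where i: "i \<le> n" "(u, k) = ?f i" using uk by (auto simp: config_eq_image)
    have "inv_into {..n} ?f (?f i) = i"
      by (rule inv_into_f_f[OF inj_on_config[OF \<beta>]]) (simp add: i(1))
    then have "f (u, k) = ?g i"
      unfolding f_def i(2) o_def by (simp only:)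
    moreover obtain c where "\<gamma> i = c *s (T *v \<beta> i)" using c[OF i(1)] ..
    moreover from this have "c \<noteq> 0"
      using \<gamma> i(1) by (auto simp: admissible_vectors_def bil_def)
    ultimately show ?thesis using i(2) by auto
  qed
  ultimately show ?thesis using T unfolding config_equiv_def by blast
qed

definition rotation :: "complex \<Rightarrow> complex \<Rightarrow> complex^2^2" where
  "rotation a b = vector [vector [a, b], vector [- b, a]]"

lemma orthogonal_rotation:
  assumes "a * a + b * b = 1" shows "orthogonal_matrix (rotation a b)"
  using assms
  by (simp add: orthogonal_matrix_def rotation_def matrix_matrix_mult_def transpose_def mat_def
      vec_eq_iff forall_2 sum_2 algebra_simps)

lemma rotation_bplus: "bplus (rotation a b *v u) = (a - \<i> * b) * bplus u"
  and rotation_bminus: "bminus (rotation a b *v u) = (a + \<i> * b) * bminus u"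
proof -
  have 1: "\<i> * \<i> = -1" by simp
  have 2: "rotation a b *v u = vector [a * u $ 1 + b * u $ 2, - b * u $ 1 + a * u $ 2]"
    by (simp add: rotation_def matrix_vector_mult_def vec_eq_iff forall_2 sum_2)
  show "bplus (rotation a b *v u) = (a - \<i> * b) * bplus u"
    using 1 unfolding bplus_def 2 vector_2 by algebra
  show "bminus (rotation a b *v u) = (a + \<i> * b) * bminus u"
    using 1 unfolding bminus_def 2 vector_2 by algebra
qed

lemma rotation_to_axis:
  assumes "bil v v \<noteq> 0"
  obtains T where "orthogonal_matrix T" "\<And>u. bil (T *v u) (T *v u) = bil u u"
    "\<And>u. line_root (T *v u) = - line_root u / line_root v"
proof -
  define s where "s = csqrt (bil v v)"
  define a where "a = v $ 1 / s"
  define b where "b = v $ 2 / s"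
  have s: "s \<noteq> 0" "s * s = bil v v"
    using assms by (simp_all add: s_def flip: power2_eq_square)
  have ab: "a * a + b * b = 1"
    using s assms by (simp add: a_def b_def bil_def flip: add_divide_distrib)
  have pm: "bplus v = s * (a + \<i> * b)" "bminus v = s * (a - \<i> * b)"
    using s(1) by (simp_all add: bplus_def bminus_def a_def b_def algebra_simps)
  have "\<i> * \<i> = -1" by simp
  then have conj: "(a + \<i> * b) * (a - \<i> * b) = 1" using ab by algebra
  then have nz: "a + \<i> * b \<noteq> 0" "a - \<i> * b \<noteq> 0" by auto
  show ?thesis
  proof (rule that[of "rotation a b"])
    show "orthogonal_matrix (rotation a b)" using ab by (rule orthogonal_rotation)
    show "bil (rotation a b *v u) (rotation a b *v u) = bil u u" for u
      unfolding bplus_bminus[symmetric] rotation_bplus rotation_bminus using conj by algebra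
    show "line_root (rotation a b *v u) = - line_root u / line_root v" for u
    proof -
      have "- (q * x) / (p * y) = - (- x / y) / (- (s * p) / (s * q))" if "p \<noteq> 0" "q \<noteq> 0" for p q x y
        using that s(1) by (cases "y = 0") (simp_all add: field_simps)
      from this[OF nz] show ?thesis
        unfolding line_root_def rotation_bplus rotation_bminus pm .
    qed
  qed
qed

lemma bplus_angle_vec: "bplus (angle_vec \<phi>) = exp (\<i> * \<phi>)"
  and bminus_angle_vec: "bminus (angle_vec \<phi>) = exp (- (\<i> * \<phi>))"
  by (simp_all add: bplus_def bminus_def angle_vec_def exp_Euler) (simp_all add: exp_minus_Euler)

lemma bil_angle_vec: "bil (angle_vec \<phi>) (angle_vec \<phi>) = 1"
  by (simp add: bplus_angle_vec bminus_angle_vec flip: bplus_bminus exp_add)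

lemma line_root_angle_vec: "line_root (angle_vec \<phi>) = - exp (2 * \<i> * \<phi>)"
  by (simp add: line_root_def bplus_angle_vec bminus_angle_vec mult.assoc flip: exp_diff)

lemma line_root_scale: "c \<noteq> 0 \<Longrightarrow> line_root (c *s u) = line_root u"
proof -
  have "bplus (c *s u) = c * bplus u" "bminus (c *s u) = c * bminus u"
    by (simp_all add: bplus_def bminus_def algebra_simps)
  then show "c \<noteq> 0 \<Longrightarrow> line_root (c *s u) = line_root u" by (simp add: line_root_def)
qed

theorem theorem7p14:
  fixes m n :: nat and A :: configuration
  assumes "m \<ge> 1" and "n \<ge> 1"
    and "config_of_type m n A"
    and "gorenstein A"
  shows "\<exists>B. special_config m n B \<and> config_equiv A B"
proof -
  obtain \<beta> where adm: "admissible_vectors n \<beta>" and A: "A = config m n \<beta>"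
    using assms(3) by (auto simp: config_of_type_def)
  have iso: "bil (\<beta> i) (\<beta> i) \<noteq> 0" if "i \<le> n" for i
    using adm that by (simp add: admissible_vectors_def)
  define \<zeta> where "\<zeta> = (\<lambda>i. line_root (\<beta> i))"
  define y where "y = (\<lambda>i. \<zeta> i / \<zeta> 0)"
  define E where "E = (\<Prod>i=1..n. [:- y i, 1:])"
  define \<phi> where "\<phi> = (\<lambda>i. ln (y i) / (2 * \<i>))"
  have \<zeta>_nz: "\<zeta> i \<noteq> 0" if "i \<le> n" for i
    using line_root_nonzero[OF iso] that by (simp add: \<zeta>_def)
  then have \<zeta>0: "\<zeta> 0 \<noteq> 0" by simp
  have y_nz: "y i \<noteq> 0" if "i \<le> n" for i
    using \<zeta>0 \<zeta>_nz[OF that] by (simp add: y_def)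
  have exp_\<phi>: "exp (2 * \<i> * \<phi> i) = y i" if "i \<le> n" for i
    using y_nz[OF that] by (simp add: \<phi>_def)
  obtain T where T: "orthogonal_matrix T" "\<And>u. bil (T *v u) (T *v u) = bil u u"
    "\<And>u. line_root (T *v u) = - line_root u / line_root (\<beta> 0)"
    using rotation_to_axis[OF iso[of 0]] by auto
  have adm': "admissible_vectors n (\<lambda>i. angle_vec (\<phi> i))"
    unfolding admissible_vectors_def
  proof (intro conjI allI impI notI)
    fix i j c assume ij: "i \<le> n" "j \<le> n" "i \<noteq> j" and c: "angle_vec (\<phi> i) = c *s angle_vec (\<phi> j)"
    have "c \<noteq> 0" using c bil_angle_vec[of "\<phi> i"] by (auto simp: bil_def)
    then have "line_root (angle_vec (\<phi> i)) = line_root (angle_vec (\<phi> j))"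
      unfolding c by (rule line_root_scale)
    then have "y i = y j"
      using ij by (simp add: line_root_angle_vec exp_\<phi>)
    then show False
      using \<zeta>0 admissible_line_root_inj[OF adm ij] by (simp add: y_def \<zeta>_def)
  qed (simp add: bil_angle_vec)
  have equiv: "config_equiv A (config m n (\<lambda>i. angle_vec (\<phi> i)))"
    unfolding A
  proof (rule config_equivI[OF T(1) adm adm'])
    fix i assume i: "i \<le> n"
    show "\<exists>c. angle_vec (\<phi> i) = c *s (T *v \<beta> i)"
      using i iso[OF i]
      by (intro line_root_eq_imp_collinear)
        (auto simp: bil_angle_vec T(2,3) line_root_angle_vec exp_\<phi> y_def \<zeta>_def)
  qed
  have E_deg: "degree E = n" unfolding E_def by (subst degree_prod_eq_sum_degree) auto
  moreover have "lead_coeff E = 1" unfolding E_def by (simp add: lead_coeff_prod)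
  ultimately have E_lead: "coeff E n = 1" by simp
  have gap: "coeff ([:- 1, 1:] ^ (2 * m - 1) * E) l = 0" if "m \<le> l" "l < m + n" for l
    unfolding E_def y_def
    by (rule gap_of_scaled_roots[where \<zeta> = \<zeta>, OF assms(1) \<zeta>0])
      (use gorenstein_imp_middle_coefficients[OF adm assms(1,2) _ that] assms(4) A in \<open>simp_all add: \<zeta>_def\<close>)
  have "elem_sym n k (\<lambda>s. exp (2 * \<i> * \<phi> s)) =
      (-1) ^ k * of_nat (n choose k) * of_nat ((m + k - 1) choose k) / of_nat ((m + n - 1) choose k)"
    if "k \<in> {1..n}" for k
  proof -
    have "(\<Prod>i=1..n. [:- exp (2 * \<i> * \<phi> i), 1:]) = E"
      unfolding E_def by (intro prod.cong refl) (simp add: exp_\<phi>)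
    then show ?thesis
      using that coeff_gap_poly[OF assms(1) _ E_lead gap, of k] E_deg
      by (simp add: elem_sym_eq_coeff)
  qed
  moreover have "\<phi> 0 = 0"
    using \<zeta>0 by (simp add: \<phi>_def y_def)
  ultimately have "special_config m n (config m n (\<lambda>i. angle_vec (\<phi> i)))"
    using adm' unfolding special_config_def by blast
  then show ?thesis using equiv by blast
qed

end
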